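(* Let $\mathcal{A}=\mathsf{PXM}$ and $\mathcal{B}=\mathsf{XM}$ (the varieties of $\Omega$-groups defined in the context). Then the commutator $[-,-]_{\mathsf{XM}}$ corresponds to the Peiffer commutator via the equivalence $\mathcal{P}$ from $\mathsf{PXM}$ to the category of precrossed modules; that is, for every $(A,d,c)\in\mathsf{PXM}$ and all ideals $(M,d,c)$, $(N,d,c)$ of $(A,d,c)$, $$\mathcal{P}\bigl([(M,d,c),(N,d,c)]_{\mathsf{XM}}\bigr)=\bigl\langle \mathcal{P}(M,d,c),\mathcal{P}(N,d,c)\bigr\rangle,$$ where the Peiffer commutator on the right is regarded as a precrossed submodule with trivial second group $\{1\}$.
   Context: Relative commutator. A variety of $\Omega$-groups $\mathcal{A}$ is a variety of universal algebras which has amongst its operations and identities those of the variety of groups but has no more than one constant (the unit $1$); thus every operation $\omega$ satisfies $\omega(1,\dots,1)=1$. An ideal of $A\in\mathcal{A}$ is a subalgebra that is the kernel of some homomorphism $A\to B$ in $\mathcal{A}$. $M\vee N$ is the subalgebra generated by $M\cup N$ and $M\wedge N$ is the intersection. Bold letters denote finite tuples, $\mathbf{x}\mathbf{y}$ is the componentwise product, and $\mathbf{m}\in M$ means that all entries lie in $M$. For a subvariety $\mathcal{B}\le\mathcal{A}$, let $W=\{v(\mathbf{x}) \mid v(\mathbf{b})=1 \text{ for all } B\in\mathcal{B},\ \mathbf{b}\in B\}$, a set of terms (elements of the free algebra of $\mathcal{A}$ on a countable set). For ideals $M,N$ of $A\in\mathcal{A}$, $[M,N]_{\mathcal{B}}$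 is the ideal of $M\vee N$ generated by $$\{v(\mathbf{m}\mathbf{n})v(\mathbf{n})^{-1}v(\mathbf{m})^{-1},\ v(\mathbf{p}) \mid v\in W,\ \mathbf{m}\in M,\ \mathbf{n}\in N,\ \mathbf{p}\in M\wedge N\}.$$ Precrossed modules. A precrossed module $(C,G,\partial)$ is a group homomorphism $\partial:C\to G$ with a left action of the group $G$ on the group $C$ such that $\partial({}^gc)=g\partial(c)g^{-1}$ for all $g\in G$, $c\in C$. A morphism $(C,G,\partial)\to(D,H,\epsilon)$ is a pair of group homomorphisms $f_1:C\to D$, $f_0:G\to H$ preserving the action with $\epsilon\circ f_1=f_0\circ\partial$. A crossed module is a precrossed module satisfying ${}^{\partial(c)}c'=cc'c^{-1}$ for all $c,c'\in C$. A precrossed submodule of $(C,G,\partial)$ is a precrossed module $(K,S,\partial)$ with $K\le C$, $S\le G$ subgroups and with action and boundary map the restrictions of those of $(C,G,\partial)$; it is normal if moreover $K$ and $S$ are normal subgroups of $C$ and $G$, and ${}^gk\in K$ and ${}^scc^{-1}\in K$ for all $c\in C$, $g\in G$, $k\in K$, $s\in S$. Peiffer commutator. For normal precrossed submodules $(K,S,\partial)$ and $(L,T,\partial)$ of a precrossed module $(C,G,\partial)$, the Peiffer commutator $\langle(K,S,\partial),(L,T,\partial)\rangle$ is the normal subgroup of the group $K\vee L$ generated by the elements $\langle k,l\rangle=klk^{-1}({}^{\partial k}l)^{-1}$ and $\langle l,k\rangle=lkl^{-1}({}^{\partial l}k)^{-1}$, with $k\in K$, $l\in L$. It is identified with the normal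 precrossed submodule $(\langle(K,S,\partial),(L,T,\partial)\rangle,\{1\},\partial)$ of $(K\vee L,S\vee T,\partial)$. The varieties. $\mathsf{PXM}$ is the variety whose algebras $(A,d,c)$ are groups $A$ with two unary operations $d,c$ satisfying $d(xy)=d(x)d(y)$, $d(1)=1$, $c(xy)=c(x)c(y)$, $c(1)=1$, $d\circ d=c\circ d=d$ and $d\circ c=c\circ c=c$. $K[d]$, $K[c]$ denote the kernels and $I[d]$ the image of the group homomorphisms $d,c:A\to A$. $\mathsf{XM}$ is the subvariety of $\mathsf{PXM}$ of all $(A,d,c)$ with $[K[d],K[c]]=1$ (ordinary group commutator). The functor $\mathcal{P}$ sends $(A,d,c)$ to the precrossed module $(K[d],I[d],c)$ with boundary map the restriction of $c$ and action ${}^gk=gkg^{-1}$ for $k\in K[d]$, $g\in I[d]$; it is an equivalence between $\mathsf{PXM}$ and the category of precrossed modules, under which $\mathsf{XM}$ corresponds to the crossed modules, subalgebras to precrossed submodules and ideals to normal precrossed submodules. For an ideal (or subalgebra) $(M,d,c)$ of $(A,d,c)$, $\mathcal{P}(M,d,c)=(K[d]\wedge M, I[d]\wedge M,c)$, a precrossed submodule of $\mathcal{P}(A,d,c)$. *)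

theory Defs
  imports "HOL-Algebra.Generated_Groups" "HOL-Algebra.Bij" "HOL-Library.Countable"
begin

section \<open>\<Omega>-groups\<close>

class signature =
  fixes arity :: "'a \<Rightarrow> nat"

text \<open>
  The group operations are part of the record, so the symbols of type \<open>'f\<close> are only the
  further operations. Values of \<open>oper A f\<close> on lists of length other than \<open>arity f\<close> are junk.
\<close>

record ('a, 'f) omega_struct = "'a monoid" +
  oper :: "'f \<Rightarrow> 'a list \<Rightarrow> 'a"

definition omega_closed :: "('a, 'f::signature) omega_struct \<Rightarrow> 'a set \<Rightarrow> bool" where
  "omega_closed A S \<longleftrightarrow>
     (\<forall>f xs. length xs = arity f \<longrightarrow> set xs \<subseteq> S \<longrightarrow> oper A f xs \<in> S)"

text \<open>Having no constant besides the unit means that every operation fixes the unit.\<close>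

definition omega_group :: "('a, 'f::signature) omega_struct \<Rightarrow> bool" where
  "omega_group A \<longleftrightarrow> group A \<and> omega_closed A (carrier A) \<and>
     (\<forall>f. oper A f (replicate (arity f) \<one>\<^bsub>A\<^esub>) = \<one>\<^bsub>A\<^esub>)"

definition omega_subalgebra :: "'a set \<Rightarrow> ('a, 'f::signature) omega_struct \<Rightarrow> bool" where
  "omega_subalgebra S A \<longleftrightarrow> subgroup S A \<and> omega_closed A S"

definition omega_hom ::
  "('a, 'f::signature) omega_struct \<Rightarrow> ('b, 'f) omega_struct \<Rightarrow> ('a \<Rightarrow> 'b) set" where
  "omega_hom A B = {h \<in> hom A B.
     \<forall>f xs. length xs = arity f \<longrightarrow> set xs \<subseteq> carrier A \<longrightarrow> h (oper A f xs) = oper B f (map h xs)}"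

text \<open>
  A variety \<open>\<V>\<close> is passed as the predicate of being one of its algebras. HOL cannot quantify over
  the type of the codomain \<open>B\<close>; the type \<open>'a set\<close> suffices since the image of a homomorphism on
  \<open>A\<close> is isomorphic to an algebra of cosets (for the variety of interest, see
  \<open>omega_ideal_kernel\<close> below).
\<close>

definition omega_ideal ::
  "(('a set, 'f::signature) omega_struct \<Rightarrow> bool) \<Rightarrow> ('a, 'f) omega_struct \<Rightarrow> 'a set \<Rightarrow> bool" where
  "omega_ideal \<V> A M \<longleftrightarrow> omega_subalgebra M A \<and>
     (\<exists>B h. \<V> B \<and> h \<in> omega_hom A B \<and> M = kernel A B h)"

definition omega_join :: "('a, 'f::signature) omega_struct \<Rightarrow> 'a set \<Rightarrow> 'a set \<Rightarrow> 'a set" where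
  "omega_join A M N = \<Inter> {S. omega_subalgebra S A \<and> M \<union> N \<subseteq> S}"

definition ideal_generated ::
  "(('a set, 'f::signature) omega_struct \<Rightarrow> bool) \<Rightarrow> ('a, 'f) omega_struct \<Rightarrow> 'a set \<Rightarrow> 'a set" where
  "ideal_generated \<V> A X = \<Inter> {I. omega_ideal \<V> A I \<and> X \<subseteq> I}"

subsection \<open>Terms and the relative commutator\<close>

datatype 'f oterm =
    Var nat
  | Unit
  | Mult "'f oterm" "'f oterm"
  | Inv "'f oterm"
  | Op 'f "'f oterm list"

primrec wf_term :: "'f::signature oterm \<Rightarrow> bool" where
  "wf_term (Var i) \<longleftrightarrow> True"
| "wf_term Unit \<longleftrightarrow> True"
| "wf_term (Mult s t) \<longleftrightarrow> wf_term s \<and> wf_term t"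
| "wf_term (Inv t) \<longleftrightarrow> wf_term t"
| "wf_term (Op f ts) \<longleftrightarrow> length ts = arity f \<and> list_all id (map wf_term ts)"

primrec eval :: "('a, 'f) omega_struct \<Rightarrow> 'f oterm \<Rightarrow> (nat \<Rightarrow> 'a) \<Rightarrow> 'a" where
  "eval A (Var i) x = x i"
| "eval A Unit x = \<one>\<^bsub>A\<^esub>"
| "eval A (Mult s t) x = eval A s x \<otimes>\<^bsub>A\<^esub> eval A t x"
| "eval A (Inv t) x = inv\<^bsub>A\<^esub> eval A t x"
| "eval A (Op f ts) x = oper A f (map (\<lambda>t. eval A t x) ts)"

text \<open>
  The set \<open>W\<close> of the subvariety \<open>\<B>\<close>. The finite tuple \<open>b\<close> is given by an assignment of all the
  variables, of which a term uses only finitely many. The test algebras live on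
  subsets of \<open>nat\<close>: an identity failing in some algebra already fails in a finitely generated,
  hence (for countably many operations) countable, subalgebra; see \<open>vanishing_terms_XM\<close> below.
\<close>

definition vanishing_terms ::
  "((nat, 'f::signature) omega_struct \<Rightarrow> bool) \<Rightarrow> 'f oterm set" where
  "vanishing_terms \<B> = {v. wf_term v \<and>
     (\<forall>B b. \<B> B \<longrightarrow> range b \<subseteq> carrier B \<longrightarrow> eval B v b = \<one>\<^bsub>B\<^esub>)}"

definition relative_commutator ::
  "(('a set, 'f::signature) omega_struct \<Rightarrow> bool) \<Rightarrow> ((nat, 'f) omega_struct \<Rightarrow> bool)
    \<Rightarrow> ('a, 'f) omega_struct \<Rightarrow> 'a set \<Rightarrow> 'a set \<Rightarrow> 'a set" where
  "relative_commutator \<V> \<B> A M N =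
     ideal_generated \<V> (A\<lparr>carrier := omega_join A M N\<rparr>)
       ({eval A v (\<lambda>i. m i \<otimes>\<^bsub>A\<^esub> n i) \<otimes>\<^bsub>A\<^esub> inv\<^bsub>A\<^esub> (eval A v n) \<otimes>\<^bsub>A\<^esub> inv\<^bsub>A\<^esub> (eval A v m) |
           v m n. v \<in> vanishing_terms \<B> \<and> range m \<subseteq> M \<and> range n \<subseteq> N} \<union>
        {eval A v p | v p. v \<in> vanishing_terms \<B> \<and> range p \<subseteq> M \<inter> N})"


section \<open>Precrossed modules\<close>

record ('c, 'g) pxmod =
  top_group :: "'c monoid"
  base_group :: "'g monoid"
  boundary :: "'c \<Rightarrow> 'g"
  action :: "'g \<Rightarrow> 'c \<Rightarrow> 'c"

text \<open>
  Boundary and action are required to be extensional, so that equality of records is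
  equality of precrossed modules.
\<close>

definition precrossed_module :: "('c, 'g) pxmod \<Rightarrow> bool" where
  "precrossed_module X \<longleftrightarrow>
     group (top_group X) \<and> group (base_group X) \<and>
     boundary X \<in> hom (top_group X) (base_group X) \<and>
     boundary X \<in> extensional (carrier (top_group X)) \<and>
     action X \<in> hom (base_group X) (AutoGroup (top_group X)) \<and>
     action X \<in> extensional (carrier (base_group X)) \<and>
     (\<forall>g \<in> carrier (base_group X). \<forall>c \<in> carrier (top_group X).
        boundary X (action X g c) =
          g \<otimes>\<^bsub>base_group X\<^esub> boundary X c \<otimes>\<^bsub>base_group X\<^esub> inv\<^bsub>base_group X\<^esub> g)"

definition restrict_pxmod :: "('c, 'g) pxmod \<Rightarrow> 'c set \<Rightarrow> 'g set \<Rightarrow> ('c, 'g) pxmod" where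
  "restrict_pxmod X K S =
     \<lparr>top_group = (top_group X)\<lparr>carrier := K\<rparr>,
      base_group = (base_group X)\<lparr>carrier := S\<rparr>,
      boundary = (\<lambda>k\<in>K. boundary X k),
      action = (\<lambda>g\<in>S. \<lambda>k\<in>K. action X g k)\<rparr>"

definition precrossed_submodule :: "('c, 'g) pxmod \<Rightarrow> ('c, 'g) pxmod \<Rightarrow> bool" where
  "precrossed_submodule Y X \<longleftrightarrow> precrossed_module Y \<and>
     subgroup (carrier (top_group Y)) (top_group X) \<and>
     subgroup (carrier (base_group Y)) (base_group X) \<and>
     Y = restrict_pxmod X (carrier (top_group Y)) (carrier (base_group Y))"

definition normal_precrossed_submodule :: "('c, 'g) pxmod \<Rightarrow> ('c, 'g) pxmod \<Rightarrow> bool" where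
  "normal_precrossed_submodule Y X \<longleftrightarrow> precrossed_submodule Y X \<and>
     carrier (top_group Y) \<lhd> top_group X \<and> carrier (base_group Y) \<lhd> base_group X \<and>
     (\<forall>g \<in> carrier (base_group X). \<forall>k \<in> carrier (top_group Y).
        action X g k \<in> carrier (top_group Y)) \<and>
     (\<forall>s \<in> carrier (base_group Y). \<forall>c \<in> carrier (top_group X).
        action X s c \<otimes>\<^bsub>top_group X\<^esub> inv\<^bsub>top_group X\<^esub> c \<in> carrier (top_group Y))"

subsection \<open>The Peiffer commutator\<close>

definition normal_closure :: "('a, 'b) monoid_scheme \<Rightarrow> 'a set \<Rightarrow> 'a set" where
  "normal_closure G X = \<Inter> {H. H \<lhd> G \<and> X \<subseteq> H}"

definition peiffer :: "('c, 'g) pxmod \<Rightarrow> 'c \<Rightarrow> 'c \<Rightarrow> 'c" where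
  "peiffer X k l = k \<otimes>\<^bsub>top_group X\<^esub> l \<otimes>\<^bsub>top_group X\<^esub> inv\<^bsub>top_group X\<^esub> k \<otimes>\<^bsub>top_group X\<^esub>
     inv\<^bsub>top_group X\<^esub> (action X (boundary X k) l)"

text \<open>
  The Peiffer commutator of two normal precrossed submodules \<open>Y\<close>, \<open>Z\<close> of \<open>X\<close>, as the precrossed
  submodule of \<open>X\<close> with trivial base group.
\<close>

definition peiffer_commutator ::
  "('c, 'g) pxmod \<Rightarrow> ('c, 'g) pxmod \<Rightarrow> ('c, 'g) pxmod \<Rightarrow> ('c, 'g) pxmod" where
  "peiffer_commutator X Y Z =
     (let K = carrier (top_group Y); L = carrier (top_group Z) in
      restrict_pxmod X
        (normal_closure ((top_group X)\<lparr>carrier := generate (top_group X) (K \<union> L)\<rparr>)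
          ({peiffer X k l | k l. k \<in> K \<and> l \<in> L} \<union> {peiffer X l k | k l. k \<in> K \<and> l \<in> L}))
        {\<one>\<^bsub>base_group X\<^esub>})"


section \<open>The varieties of precrossed and crossed modules\<close>

datatype pxm_op = Dom | Cod

instantiation pxm_op :: signature
begin
definition arity_pxm_op :: "pxm_op \<Rightarrow> nat" where "arity_pxm_op f = 1"
instance ..
end

abbreviation dmap :: "('a, pxm_op) omega_struct \<Rightarrow> 'a \<Rightarrow> 'a" where
  "dmap A x \<equiv> oper A Dom [x]"

abbreviation cmap :: "('a, pxm_op) omega_struct \<Rightarrow> 'a \<Rightarrow> 'a" where
  "cmap A x \<equiv> oper A Cod [x]"

definition PXM :: "('a, pxm_op) omega_struct \<Rightarrow> bool" where
  "PXM A \<longleftrightarrow> omega_group A \<and>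
     (\<forall>x \<in> carrier A. \<forall>y \<in> carrier A. dmap A (x \<otimes>\<^bsub>A\<^esub> y) = dmap A x \<otimes>\<^bsub>A\<^esub> dmap A y) \<and>
     dmap A \<one>\<^bsub>A\<^esub> = \<one>\<^bsub>A\<^esub> \<and>
     (\<forall>x \<in> carrier A. \<forall>y \<in> carrier A. cmap A (x \<otimes>\<^bsub>A\<^esub> y) = cmap A x \<otimes>\<^bsub>A\<^esub> cmap A y) \<and>
     cmap A \<one>\<^bsub>A\<^esub> = \<one>\<^bsub>A\<^esub> \<and>
     (\<forall>x \<in> carrier A. dmap A (dmap A x) = dmap A x \<and> cmap A (dmap A x) = dmap A x \<and>
        dmap A (cmap A x) = cmap A x \<and> cmap A (cmap A x) = cmap A x)"

definition group_commutator :: "('a, 'b) monoid_scheme \<Rightarrow> 'a set \<Rightarrow> 'a set \<Rightarrow> 'a set" where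
  "group_commutator G H K =
     generate G {h \<otimes>\<^bsub>G\<^esub> k \<otimes>\<^bsub>G\<^esub> inv\<^bsub>G\<^esub> h \<otimes>\<^bsub>G\<^esub> inv\<^bsub>G\<^esub> k | h k. h \<in> H \<and> k \<in> K}"

definition XM :: "('a, pxm_op) omega_struct \<Rightarrow> bool" where
  "XM A \<longleftrightarrow> PXM A \<and>
     group_commutator A (kernel A A (dmap A)) (kernel A A (cmap A)) = {\<one>\<^bsub>A\<^esub>}"

text \<open>The functor \<open>\<P>\<close> on objects.\<close>

definition pxm_to_pxmod :: "('a, pxm_op) omega_struct \<Rightarrow> ('a, 'a) pxmod" where
  "pxm_to_pxmod A =
     (let K = kernel A A (dmap A); I = dmap A ` carrier A in
      \<lparr>top_group = \<lparr>carrier = K, mult = mult A, one = \<one>\<^bsub>A\<^esub>\<rparr>,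
       base_group = \<lparr>carrier = I, mult = mult A, one = \<one>\<^bsub>A\<^esub>\<rparr>,
       boundary = (\<lambda>k\<in>K. cmap A k),
       action = (\<lambda>g\<in>I. \<lambda>k\<in>K. g \<otimes>\<^bsub>A\<^esub> k \<otimes>\<^bsub>A\<^esub> inv\<^bsub>A\<^esub> g)\<rparr>)"


section \<open>The choice of carrier types is immaterial\<close>

lemma omega_closedD:
  "\<lbrakk>omega_closed A S; length xs = arity f; set xs \<subseteq> S\<rbrakk> \<Longrightarrow> oper A f xs \<in> S"
  by (simp add: omega_closed_def)

lemma omega_copy:
  fixes B :: "('b, 'f::signature) omega_struct" and \<phi> :: "'b \<Rightarrow> 'c"
  assumes B: "omega_group B" and S: "omega_subalgebra S B" and inj: "inj_on \<phi> S"
  obtains C where "omega_group C" "carrier C = \<phi> ` S" "\<one>\<^bsub>C\<^esub> = \<phi> \<one>\<^bsub>B\<^esub>"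
    "the_inv_into S \<phi> \<in> omega_hom C B" "\<phi> \<in> omega_hom (B\<lparr>carrier := S\<rparr>) C"
proof -
  define \<psi> where "\<psi> = the_inv_into S \<phi>"
  have psi [simp]: "\<psi> (\<phi> s) = s" if "s \<in> S" for s
    using that inj by (simp add: \<psi>_def the_inv_into_f_f)
  define C where "C = \<lparr>carrier = \<phi> ` S, mult = (\<lambda>x y. \<phi> (\<psi> x \<otimes>\<^bsub>B\<^esub> \<psi> y)), one = \<phi> \<one>\<^bsub>B\<^esub>,
    oper = (\<lambda>f xs. \<phi> (oper B f (map \<psi> xs)))\<rparr>"
  interpret B: group B using B by (simp add: omega_group_def)
  interpret S: subgroup S B using S by (simp add: omega_subalgebra_def)
  have clS: "omega_closed B S" using S by (simp add: omega_subalgebra_def)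
  have psiS: "set (map \<psi> xs) \<subseteq> S" if "set xs \<subseteq> \<phi> ` S" for xs
    using that by auto
  have "group C"
  proof (rule groupI)
    fix x assume "x \<in> carrier C"
    then obtain s where "x = \<phi> s" "s \<in> S" by (auto simp: C_def)
    then show "\<exists>y\<in>carrier C. y \<otimes>\<^bsub>C\<^esub> x = \<one>\<^bsub>C\<^esub>"
      by (intro bexI[of _ "\<phi> (inv\<^bsub>B\<^esub> s)"]) (auto simp: C_def)
  qed (auto simp: C_def B.m_assoc)
  moreover have "omega_closed C (carrier C)"
    using psiS omega_closedD[OF clS] by (auto simp: omega_closed_def C_def)
  moreover have "oper C f (replicate (arity f) \<one>\<^bsub>C\<^esub>) = \<one>\<^bsub>C\<^esub>" for f
    using B by (simp add: C_def omega_group_def)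
  ultimately have "omega_group C" by (simp add: omega_group_def)
  moreover have "\<psi> \<in> omega_hom C B"
    using psiS omega_closedD[OF clS] by (auto simp: omega_hom_def hom_def C_def)
  moreover have "map (\<psi> \<circ> \<phi>) xs = xs" if "set xs \<subseteq> S" for xs
    using that by (intro map_idI) auto
  then have "\<phi> \<in> omega_hom (B\<lparr>carrier := S\<rparr>) C"
    by (auto simp: omega_hom_def hom_def C_def)
  ultimately show thesis using that by (simp add: \<psi>_def C_def)
qed

lemma PXM_inj_hom:
  assumes C: "omega_group C" and B: "PXM B" and h: "h \<in> omega_hom C B"
    and inj: "inj_on h (carrier C)"
  shows "PXM C"
proof -
  interpret C: group C using C by (simp add: omega_group_def)
  interpret B: group B using B by (simp add: PXM_def omega_group_def)
  interpret h: group_hom C B h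
    using h by unfold_locales (simp add: omega_hom_def)
  have cl [simp]: "oper C f [x] \<in> carrier C" if "x \<in> carrier C" for f x
    using C that by (simp add: omega_group_def omega_closed_def arity_pxm_op_def)
  have op [simp]: "h (oper C f [x]) = oper B f [h x]" if "x \<in> carrier C" for f x
    using h that by (simp add: omega_hom_def arity_pxm_op_def)
  have "oper C f [\<one>\<^bsub>C\<^esub>] = \<one>\<^bsub>C\<^esub>" for f
    using C by (simp add: omega_group_def arity_pxm_op_def)
  then show ?thesis
    using B C unfolding PXM_def by (auto intro!: inj_onD[OF inj])
qed

lemma (in group) group_commutator_trivial:
  assumes "H \<subseteq> carrier G" "K \<subseteq> carrier G"
  shows "group_commutator G H K = {\<one>} \<longleftrightarrow>
    (\<forall>h \<in> H. \<forall>k \<in> K. h \<otimes> k \<otimes> inv h \<otimes> inv k = \<one>)"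
proof
  assume *: "group_commutator G H K = {\<one>}"
  have "h \<otimes> k \<otimes> inv h \<otimes> inv k \<in> group_commutator G H K" if "h \<in> H" "k \<in> K" for h k
    unfolding group_commutator_def by (rule generate.incl) (use that in auto)
  with * show "\<forall>h \<in> H. \<forall>k \<in> K. h \<otimes> k \<otimes> inv h \<otimes> inv k = \<one>"
    by simp
next
  assume *: "\<forall>h \<in> H. \<forall>k \<in> K. h \<otimes> k \<otimes> inv h \<otimes> inv k = \<one>"
  have "group_commutator G H K \<subseteq> {\<one>}"
    unfolding group_commutator_def
    by (rule generate_subgroup_incl) (use * triv_subgroup in auto)
  moreover have "\<one> \<in> group_commutator G H K"
    unfolding group_commutator_def by (rule generate.one)
  ultimately show "group_commutator G H K = {\<one>}" by auto
qed

lemma XM_inj_hom: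
  assumes C: "omega_group C" and B: "XM B" and h: "h \<in> omega_hom C B"
    and inj: "inj_on h (carrier C)"
  shows "XM C"
proof -
  have PB: "PXM B" using B by (simp add: XM_def)
  have PC: "PXM C" using PXM_inj_hom[OF C PB h inj] .
  interpret C: group C using C by (simp add: omega_group_def)
  interpret B: group B using PB by (simp add: PXM_def omega_group_def)
  interpret h: group_hom C B h
    using h by unfold_locales (simp add: omega_hom_def)
  have op: "oper B f [h x] = h (oper C f [x])" if "x \<in> carrier C" for f x
    using h that by (simp add: omega_hom_def arity_pxm_op_def)
  have ker: "h x \<in> kernel B B (\<lambda>x. oper B f [x])" if "x \<in> kernel C C (\<lambda>x. oper C f [x])" for f x
    using that by (auto simp: kernel_def op)
  have "x \<otimes>\<^bsub>C\<^esub> y \<otimes>\<^bsub>C\<^esub> inv\<^bsub>C\<^esub> x \<otimes>\<^bsub>C\<^esub> inv\<^bsub>C\<^esub> y = \<one>\<^bsub>C\<^esub>"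
    if xy: "x \<in> kernel C C (dmap C)" "y \<in> kernel C C (cmap C)" for x y
  proof (rule inj_onD[OF inj])
    have "h x \<otimes>\<^bsub>B\<^esub> h y \<otimes>\<^bsub>B\<^esub> inv\<^bsub>B\<^esub> (h x) \<otimes>\<^bsub>B\<^esub> inv\<^bsub>B\<^esub> (h y) = \<one>\<^bsub>B\<^esub>"
      using B B.group_commutator_trivial[of "kernel B B (dmap B)" "kernel B B (cmap B)"] ker xy
      by (auto simp: XM_def kernel_def)
    then show "h (x \<otimes>\<^bsub>C\<^esub> y \<otimes>\<^bsub>C\<^esub> inv\<^bsub>C\<^esub> x \<otimes>\<^bsub>C\<^esub> inv\<^bsub>C\<^esub> y) = h \<one>\<^bsub>C\<^esub>"
      using xy by (simp add: kernel_def)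
  qed (use xy in \<open>auto simp: kernel_def\<close>)
  then show ?thesis
    using PC C.group_commutator_trivial[of "kernel C C (dmap C)" "kernel C C (cmap C)"]
    by (auto simp: XM_def kernel_def)
qed

text \<open>Kernels of homomorphisms to algebras over an arbitrary type are ideals.\<close>

lemma omega_ideal_kernel:
  fixes A :: "('a, pxm_op) omega_struct" and B :: "('b, pxm_op) omega_struct"
  assumes A: "PXM A" and B: "PXM B" and h: "h \<in> omega_hom A B"
  shows "omega_ideal PXM A (kernel A B h)"
proof -
  interpret A: group A using A by (simp add: PXM_def omega_group_def)
  interpret B: group B using B by (simp add: PXM_def omega_group_def)
  interpret h: group_hom A B h
    using h by unfold_locales (simp add: omega_hom_def)
  have one: "oper A f [\<one>\<^bsub>A\<^esub>] = \<one>\<^bsub>A\<^esub>" "oper B f [\<one>\<^bsub>B\<^esub>] = \<one>\<^bsub>B\<^esub>" for f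
    using A B by (auto simp: PXM_def omega_group_def arity_pxm_op_def)
  have cl [simp]: "oper A f [x] \<in> carrier A" if "x \<in> carrier A" for f x
    using A that by (simp add: PXM_def omega_group_def omega_closed_def arity_pxm_op_def)
  have op [simp]: "h (oper A f [x]) = oper B f [h x]" if "x \<in> carrier A" for f x
    using h that by (simp add: omega_hom_def arity_pxm_op_def)
  define S where "S = h ` carrier A"
  define \<phi> where "\<phi> y = {x \<in> carrier A. h x = y}" for y
  have inj: "inj_on \<phi> S" by (force simp: inj_on_def S_def \<phi>_def)
  have "omega_closed B S"
    unfolding omega_closed_def S_def
    by (auto simp: arity_pxm_op_def length_Suc_conv simp flip: op)
  then have S: "omega_subalgebra S B"
    using h.img_is_subgroup by (simp add: omega_subalgebra_def S_def)
  obtain C where C: "omega_group C" "carrier C = \<phi> ` S" "\<one>\<^bsub>C\<^esub> = \<phi> \<one>\<^bsub>B\<^esub>"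
    "the_inv_into S \<phi> \<in> omega_hom C B" "\<phi> \<in> omega_hom (B\<lparr>carrier := S\<rparr>) C"
    using omega_copy[OF _ S inj] B by (auto simp: PXM_def)
  have "PXM C"
    by (rule PXM_inj_hom[OF C(1) B C(4)]) (use C(2) inj inj_on_the_inv_into in auto)
  moreover have "\<phi> \<circ> h \<in> omega_hom A C"
    using h C(5) by (auto simp: omega_hom_def hom_def S_def arity_pxm_op_def length_Suc_conv)
  moreover have "kernel A B h = kernel A C (\<phi> \<circ> h)"
    using C(3) inj S by (auto simp: kernel_def S_def inj_on_def omega_subalgebra_def subgroup_def)
  moreover have "omega_subalgebra (kernel A B h) A"
    using h.subgroup_kernel
    by (auto simp: omega_subalgebra_def omega_closed_def arity_pxm_op_def length_Suc_conv
        kernel_def one)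
  ultimately show ?thesis by (auto simp: omega_ideal_def)
qed

lemma eval_omega_hom:
  assumes "omega_group C" "omega_group B" "h \<in> omega_hom C B" "wf_term t" "range x \<subseteq> carrier C"
  shows "eval C t x \<in> carrier C \<and> h (eval C t x) = eval B t (h \<circ> x)"
  using \<open>wf_term t\<close>
proof (induction t)
  case (Op f ts)
  have *: "eval C t x \<in> carrier C \<and> h (eval C t x) = eval B t (h \<circ> x)" if "t \<in> set ts" for t
    using Op.IH[OF that] Op.prems that by (simp add: list_all_iff comp_def)
  have "set (map (\<lambda>t. eval C t x) ts) \<subseteq> carrier C" "length (map (\<lambda>t. eval C t x) ts) = arity f"
    using * Op by auto
  then have "oper C f (map (\<lambda>t. eval C t x) ts) \<in> carrier C"
    "h (oper C f (map (\<lambda>t. eval C t x) ts)) = oper B f (map h (map (\<lambda>t. eval C t x) ts))"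
    using assms(1,3) by (auto simp: omega_group_def omega_closed_def omega_hom_def)
  moreover have "map h (map (\<lambda>t. eval C t x) ts) = map (\<lambda>t. eval B t (h \<circ> x)) ts"
    using * by simp
  ultimately show ?case by (simp only: eval.simps simp_thms)
next
  case (Inv t)
  interpret h: group_hom C B h
    using assms by (auto simp: omega_group_def omega_hom_def group_hom_def group_hom_axioms_def)
  from Inv show ?case by simp
next
  case (Mult s t)
  interpret h: group_hom C B h
    using assms by (auto simp: omega_group_def omega_hom_def group_hom_def group_hom_axioms_def)
  from Mult show ?case by simp
next
  case Unit
  interpret h: group_hom C B h
    using assms by (auto simp: omega_group_def omega_hom_def group_hom_def group_hom_axioms_def)
  show ?case by simp
qed (use assms(5) in auto)

instance pxm_op :: countable by countable_datatype
instance oterm :: (countable) countable by countable_datatype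

text \<open>Terms vanishing on the crossed modules over \<open>nat\<close> vanish on all crossed modules.\<close>

lemma vanishing_terms_XM:
  fixes B :: "('b, pxm_op) omega_struct"
  assumes v: "v \<in> vanishing_terms XM" and B: "XM B" and b: "range b \<subseteq> carrier B"
  shows "eval B v b = \<one>\<^bsub>B\<^esub>"
proof -
  have wf: "wf_term v" using v by (simp add: vanishing_terms_def)
  have og: "omega_group B" using B by (simp add: XM_def PXM_def)
  interpret B: group B using og by (simp add: omega_group_def)
  define S where "S = {eval B t b | t. wf_term t}"
  have "id \<in> omega_hom B B" by (auto simp: omega_hom_def hom_def)
  then have evc: "eval B t b \<in> carrier B" if "wf_term t" for t
    using eval_omega_hom[OF og og _ that b, of id] by simp
  have bS: "b i \<in> S" for i
    unfolding S_def by (auto intro!: exI[of _ "Var i"])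
  have "subgroup S B"
  proof (rule B.subgroupI)
    show "S \<subseteq> carrier B" using evc by (auto simp: S_def)
    show "S \<noteq> {}" using bS by auto
    show "inv\<^bsub>B\<^esub> a \<in> S" if "a \<in> S" for a
    proof -
      from that obtain t where "wf_term t" "a = eval B t b" by (auto simp: S_def)
      then show ?thesis by (auto simp: S_def intro!: exI[of _ "Inv t"])
    qed
    show "a \<otimes>\<^bsub>B\<^esub> c \<in> S" if "a \<in> S" "c \<in> S" for a c
    proof -
      from that obtain t u where "wf_term t" "a = eval B t b" "wf_term u" "c = eval B u b"
        by (auto simp: S_def)
      then show ?thesis by (auto simp: S_def intro!: exI[of _ "Mult t u"])
    qed
  qed
  moreover have "oper B f [eval B t b] \<in> S" if "wf_term t" for f t
    unfolding S_def using that by (auto intro!: exI[of _ "Op f [t]"] simp: arity_pxm_op_def)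
  then have "omega_closed B S"
    by (auto simp: omega_closed_def arity_pxm_op_def length_Suc_conv) (auto simp: S_def)
  ultimately have S: "omega_subalgebra S B" by (simp add: omega_subalgebra_def)
  define r where "r s = (SOME t. wf_term t \<and> eval B t b = s)" for s
  have sel: "eval B (r s) b = s" if "s \<in> S" for s
    unfolding r_def by (rule someI2_ex) (use that in \<open>auto simp: S_def\<close>)
  define \<phi> where "\<phi> s = to_nat (r s)" for s
  have inj: "inj_on \<phi> S"
  proof (rule inj_onI)
    fix s t assume "s \<in> S" "t \<in> S" "\<phi> s = \<phi> t"
    moreover from this have "r s = r t" by (simp add: \<phi>_def)
    ultimately show "s = t" using sel by metis
  qed
  obtain C where C: "omega_group C" "carrier C = \<phi> ` S" "\<one>\<^bsub>C\<^esub> = \<phi> \<one>\<^bsub>B\<^esub>"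
    "the_inv_into S \<phi> \<in> omega_hom C B" "\<phi> \<in> omega_hom (B\<lparr>carrier := S\<rparr>) C"
    using omega_copy[OF og S inj] by auto
  have "XM C"
    by (rule XM_inj_hom[OF C(1) B C(4)]) (use C(2) inj inj_on_the_inv_into in auto)
  moreover have rg: "range (\<phi> \<circ> b) \<subseteq> carrier C" using C(2) bS by auto
  ultimately have "eval C v (\<phi> \<circ> b) = \<one>\<^bsub>C\<^esub>"
    using v by (auto simp: vanishing_terms_def)
  moreover have "the_inv_into S \<phi> \<circ> (\<phi> \<circ> b) = b"
    using bS inj by (auto simp: the_inv_into_f_f fun_eq_iff)
  moreover have "the_inv_into S \<phi> \<one>\<^bsub>C\<^esub> = \<one>\<^bsub>B\<^esub>"
    using C(3) inj S by (simp add: the_inv_into_f_f omega_subalgebra_def subgroup.one_closed)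
  ultimately show ?thesis
    using eval_omega_hom[OF C(1) og C(4) wf rg] by simp
qed



section \<open>The functor on algebras and ideals\<close>

lemma PXM_facts:
  assumes "PXM A"
  shows "group A" "group_hom A A (dmap A)" "group_hom A A (cmap A)"
    and "x \<in> carrier A \<Longrightarrow> oper A f [x] \<in> carrier A"
    and "x \<in> carrier A \<Longrightarrow> oper A f [oper A g [x]] = oper A g [x]"
proof -
  show g: "group A" using assms by (simp add: PXM_def omega_group_def)
  show cl: "x \<in> carrier A \<Longrightarrow> oper A f [x] \<in> carrier A" for x f
    using assms by (simp add: PXM_def omega_group_def omega_closed_def arity_pxm_op_def)
  show "group_hom A A (dmap A)" "group_hom A A (cmap A)"
    using assms g cl by (auto simp: PXM_def group_hom_def group_hom_axioms_def hom_def)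
  show "x \<in> carrier A \<Longrightarrow> oper A f [oper A g [x]] = oper A g [x]"
    using assms by (cases f; cases g) (auto simp: PXM_def)
qed

lemma (in group) subgroup_monoid:
  assumes "subgroup H G"
  shows "group \<lparr>carrier = H, mult = mult G, one = \<one>\<rparr>"
    and "x \<in> H \<Longrightarrow> inv\<^bsub>\<lparr>carrier = H, mult = mult G, one = \<one>\<rparr>\<^esub> x = inv x"
proof -
  interpret H: subgroup H G by fact
  show *: "group \<lparr>carrier = H, mult = mult G, one = \<one>\<rparr>"
    by (rule groupI) (auto simp: m_assoc intro!: bexI[of _ "inv x" for x])
  show "inv\<^bsub>\<lparr>carrier = H, mult = mult G, one = \<one>\<rparr>\<^esub> x = inv x" if "x \<in> H"
    by (rule group.inv_equality[OF *]) (use that in auto)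
qed

lemma (in group) subgroup_monoid_subgroup:
  assumes "subgroup H G" "subgroup K G" "K \<subseteq> H"
  shows "subgroup K \<lparr>carrier = H, mult = mult G, one = \<one>\<rparr>"
  using assms subgroup_monoid[OF assms(1)]
  by (auto simp: subgroup_def subset_iff)

lemma precrossed_module_pxm:
  assumes "PXM A"
  shows "precrossed_module (pxm_to_pxmod A)"
proof -
  interpret A: group A using PXM_facts(1)[OF assms] .
  interpret d: group_hom A A "dmap A" using PXM_facts(2)[OF assms] .
  interpret c: group_hom A A "cmap A" using PXM_facts(3)[OF assms] .
  note [simp] = PXM_facts(4,5)[OF assms]
  define K where "K = kernel A A (dmap A)"
  define I where "I = dmap A ` carrier A"
  have K: "subgroup K A" using d.subgroup_kernel by (simp add: K_def)
  have I: "subgroup I A" using d.img_is_subgroup by (simp add: I_def)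
  have KD: "x \<in> carrier A" "dmap A x = \<one>\<^bsub>A\<^esub>" if "x \<in> K" for x
    using that by (auto simp: K_def kernel_def)
  have IfixD: "x \<in> carrier A" "dmap A x = x" "cmap A x = x" if "x \<in> I" for x
    using that by (auto simp: I_def)
  have cI: "cmap A x \<in> I" if "x \<in> carrier A" for x
    using that by (auto simp: I_def intro!: image_eqI[of _ _ "cmap A x"])
  have conj: "g \<otimes>\<^bsub>A\<^esub> k \<otimes>\<^bsub>A\<^esub> inv\<^bsub>A\<^esub> g \<in> K" if "g \<in> carrier A" "k \<in> K" for g k
    using that(1) KD[OF that(2)] by (simp add: K_def kernel_def)
  define act where "act = (\<lambda>g\<in>I. \<lambda>k\<in>K. g \<otimes>\<^bsub>A\<^esub> k \<otimes>\<^bsub>A\<^esub> inv\<^bsub>A\<^esub> g)"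
  let ?K = "\<lparr>carrier = K, mult = mult A, one = \<one>\<^bsub>A\<^esub>\<rparr>"
  let ?I = "\<lparr>carrier = I, mult = mult A, one = \<one>\<^bsub>A\<^esub>\<rparr>"
  have P: "pxm_to_pxmod A = \<lparr>top_group = ?K, base_group = ?I,
      boundary = (\<lambda>k\<in>K. cmap A k), action = act\<rparr>"
    by (simp add: pxm_to_pxmod_def Let_def act_def K_def I_def)
  have auto: "act g \<in> carrier (AutoGroup ?K)" if "g \<in> I" for g
  proof -
    have g: "g \<in> carrier A" using IfixD that by auto
    have "act g \<in> hom ?K ?K"
      using g that conj subgroup.m_closed[OF K] KD
      by (auto simp: hom_def act_def A.m_assoc A.inv_solve_left)
    moreover have "bij_betw (act g) K K"
    proof (rule bij_betwI[where g = "\<lambda>k. inv\<^bsub>A\<^esub> g \<otimes>\<^bsub>A\<^esub> k \<otimes>\<^bsub>A\<^esub> g"])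
      show "(\<lambda>k. inv\<^bsub>A\<^esub> g \<otimes>\<^bsub>A\<^esub> k \<otimes>\<^bsub>A\<^esub> g) \<in> K \<rightarrow> K"
        using conj[of "inv\<^bsub>A\<^esub> g"] g by auto
      show "inv\<^bsub>A\<^esub> g \<otimes>\<^bsub>A\<^esub> act g x \<otimes>\<^bsub>A\<^esub> g = x" if "x \<in> K" for x
        using g that \<open>g \<in> I\<close> KD by (simp add: act_def A.m_assoc flip: A.m_assoc[of "inv\<^bsub>A\<^esub> g" g])
      show "act g (inv\<^bsub>A\<^esub> g \<otimes>\<^bsub>A\<^esub> y \<otimes>\<^bsub>A\<^esub> g) = y" if "y \<in> K" for y
        using g that \<open>g \<in> I\<close> KD conj[of "inv\<^bsub>A\<^esub> g" y]
        by (simp add: act_def A.m_assoc flip: A.m_assoc[of g "inv\<^bsub>A\<^esub> g"])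
    qed (use that g conj in \<open>auto simp: act_def\<close>)
    ultimately show ?thesis
      using that by (auto simp: AutoGroup_def auto_def Bij_def act_def)
  qed
  have "act (g \<otimes>\<^bsub>A\<^esub> h) = compose K (act g) (act h)" if "g \<in> I" "h \<in> I" for g h
    using that subgroup.m_closed[OF I] IfixD KD conj
    by (auto simp: act_def compose_def fun_eq_iff A.inv_mult_group A.m_assoc)
  then have "act \<in> hom ?I (AutoGroup ?K)"
    using auto by (auto simp: hom_def AutoGroup_def BijGroup_def auto_def)
  moreover have "cmap A (act g k) = g \<otimes>\<^bsub>A\<^esub> cmap A k \<otimes>\<^bsub>A\<^esub> inv\<^bsub>A\<^esub> g" if "g \<in> I" "k \<in> K" for g k
    using that IfixD KD by (simp add: act_def)
  moreover have "act g k \<in> K" if "g \<in> I" "k \<in> K" for g k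
    using that conj IfixD by (simp add: act_def)
  ultimately show ?thesis
    unfolding precrossed_module_def P
    using A.subgroup_monoid[OF K] A.subgroup_monoid[OF I] cI KD subgroup.m_closed[OF K]
    by (auto simp: hom_def act_def)
qed

lemma omega_subalgebra_PXM:
  assumes A: "PXM A" and M: "omega_subalgebra M A"
  shows "PXM (A\<lparr>carrier := M\<rparr>)"
proof (rule PXM_inj_hom[OF _ A])
  interpret A: group A using PXM_facts(1)[OF A] .
  interpret M: subgroup M A using M by (simp add: omega_subalgebra_def)
  show "omega_group (A\<lparr>carrier := M\<rparr>)"
    using A M A.subgroup_imp_group[OF M.subgroup_axioms]
    by (auto simp: omega_group_def PXM_def omega_subalgebra_def omega_closed_def)
  show "id \<in> omega_hom (A\<lparr>carrier := M\<rparr>) A"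
    by (auto simp: omega_hom_def hom_def)
qed simp

lemma pxm_to_pxmod_subalgebra:
  assumes A: "PXM A" and M: "omega_subalgebra M A"
  shows "pxm_to_pxmod (A\<lparr>carrier := M\<rparr>) =
    restrict_pxmod (pxm_to_pxmod A) (kernel A A (dmap A) \<inter> M) (dmap A ` carrier A \<inter> M)"
proof -
  interpret A: group A using PXM_facts(1)[OF A] .
  interpret M: subgroup M A using M by (simp add: omega_subalgebra_def)
  note [simp] = PXM_facts(4,5)[OF A]
  have dM: "dmap A x \<in> M" if "x \<in> M" for x
    using M that by (simp add: omega_subalgebra_def omega_closed_def arity_pxm_op_def)
  have K: "kernel (A\<lparr>carrier := M\<rparr>) (A\<lparr>carrier := M\<rparr>) (dmap A) = kernel A A (dmap A) \<inter> M"
    by (auto simp: kernel_def)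
  have I: "dmap A ` M = dmap A ` carrier A \<inter> M"
  proof (intro equalityI subsetI)
    fix y assume y: "y \<in> dmap A ` carrier A \<inter> M"
    then have "y = dmap A y" by auto
    with y show "y \<in> dmap A ` M" by blast
  qed (use dM in auto)
  have "inv\<^bsub>A\<lparr>carrier := M\<rparr>\<^esub> g = inv\<^bsub>A\<^esub> g" if "g \<in> M" for g
    using A.m_inv_consistent[OF M.subgroup_axioms that] .
  then show ?thesis
    by (auto simp: pxm_to_pxmod_def restrict_pxmod_def Let_def K I fun_eq_iff restrict_def)
qed

lemma normal_precrossed_submodule_pxm:
  assumes A: "PXM A" and M: "omega_ideal PXM A M"
  shows "normal_precrossed_submodule (pxm_to_pxmod (A\<lparr>carrier := M\<rparr>)) (pxm_to_pxmod A)"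
proof -
  interpret A: group A using PXM_facts(1)[OF A] .
  interpret d: group_hom A A "dmap A" using PXM_facts(2)[OF A] .
  note [simp] = PXM_facts(4,5)[OF A]
  define K where "K = kernel A A (dmap A)"
  define I where "I = dmap A ` carrier A"
  have subM: "omega_subalgebra M A" using M by (simp add: omega_ideal_def)
  obtain B :: "('a set, pxm_op) omega_struct" and h
    where B: "PXM B" "h \<in> omega_hom A B" "M = kernel A B h"
    using M unfolding omega_ideal_def by blast
  interpret h: group_hom A B h
    using B PXM_facts(1) by (auto simp: group_hom_def group_hom_axioms_def omega_hom_def)
  interpret M: normal M A using h.normal_kernel B(3) by simp
  have K: "subgroup K A" using d.subgroup_kernel by (simp add: K_def)
  have I: "subgroup I A" using d.img_is_subgroup by (simp add: I_def)
  note sK = A.subgroup_monoid[OF K] and sI = A.subgroup_monoid[OF I]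
  have KD: "x \<in> carrier A" "dmap A x = \<one>\<^bsub>A\<^esub>" if "x \<in> K" for x
    using that by (auto simp: K_def kernel_def)
  have IA: "x \<in> carrier A" if "x \<in> I" for x
    using that by (auto simp: I_def)
  have conj: "g \<otimes>\<^bsub>A\<^esub> k \<otimes>\<^bsub>A\<^esub> inv\<^bsub>A\<^esub> g \<in> K" if "g \<in> carrier A" "k \<in> K" for g k
    using that(1) KD[OF that(2)] by (simp add: K_def kernel_def)
  have KM: "subgroup (K \<inter> M) A" and IM: "subgroup (I \<inter> M) A"
    using K I M.subgroup_axioms A.subgroups_Inter_pair by auto
  let ?K = "\<lparr>carrier = K, mult = mult A, one = \<one>\<^bsub>A\<^esub>\<rparr>"
  let ?I = "\<lparr>carrier = I, mult = mult A, one = \<one>\<^bsub>A\<^esub>\<rparr>"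
  have P: "pxm_to_pxmod A = \<lparr>top_group = ?K, base_group = ?I, boundary = (\<lambda>k\<in>K. cmap A k),
      action = (\<lambda>g\<in>I. \<lambda>k\<in>K. g \<otimes>\<^bsub>A\<^esub> k \<otimes>\<^bsub>A\<^esub> inv\<^bsub>A\<^esub> g)\<rparr>"
    by (simp add: pxm_to_pxmod_def Let_def K_def I_def)
  have PM: "pxm_to_pxmod (A\<lparr>carrier := M\<rparr>) = restrict_pxmod (pxm_to_pxmod A) (K \<inter> M) (I \<inter> M)"
    using pxm_to_pxmod_subalgebra[OF A subM] by (simp add: K_def I_def)
  have "precrossed_module (pxm_to_pxmod (A\<lparr>carrier := M\<rparr>))"
    using precrossed_module_pxm[OF omega_subalgebra_PXM[OF A subM]] .
  moreover have "K \<inter> M \<lhd> ?K"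
    using A.subgroup_monoid_subgroup[OF K KM] M.inv_op_closed2 KD sK conj
    by (auto simp: group.normal_inv_iff[OF sK(1)])
  moreover have "I \<inter> M \<lhd> ?I"
    using A.subgroup_monoid_subgroup[OF I IM] M.inv_op_closed2 IA sI
      subgroup.m_closed[OF I] subgroup.m_inv_closed[OF I]
    by (auto simp: group.normal_inv_iff[OF sI(1)])
  moreover have "g \<otimes>\<^bsub>A\<^esub> k \<otimes>\<^bsub>A\<^esub> inv\<^bsub>A\<^esub> g \<in> K \<inter> M" if "g \<in> I" "k \<in> K \<inter> M" for g k
    using that conj IA M.inv_op_closed2 by auto
  moreover have "s \<otimes>\<^bsub>A\<^esub> c \<otimes>\<^bsub>A\<^esub> inv\<^bsub>A\<^esub> s \<otimes>\<^bsub>A\<^esub> inv\<^bsub>?K\<^esub> c \<in> K \<inter> M"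
    if s: "s \<in> I \<inter> M" and c: "c \<in> K" for s c
  proof -
    have "s \<otimes>\<^bsub>A\<^esub> (c \<otimes>\<^bsub>A\<^esub> inv\<^bsub>A\<^esub> s \<otimes>\<^bsub>A\<^esub> inv\<^bsub>A\<^esub> c) \<in> M"
      using s c KD M.inv_op_closed2[of c "inv\<^bsub>A\<^esub> s"] by auto
    moreover have "(s \<otimes>\<^bsub>A\<^esub> c \<otimes>\<^bsub>A\<^esub> inv\<^bsub>A\<^esub> s) \<otimes>\<^bsub>A\<^esub> inv\<^bsub>A\<^esub> c \<in> K"
      using s c IA conj subgroup.m_closed[OF K] subgroup.m_inv_closed[OF K] by auto
    ultimately show ?thesis
      using s c KD IA sK by (auto simp: A.m_assoc)
  qed
  ultimately show ?thesis
    unfolding normal_precrossed_submodule_def precrossed_submodule_def PM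
    by (auto simp: P restrict_pxmod_def normal_imp_subgroup)
qed

end

theory Submission
  imports Defs
begin

text \<open>
  Write \<open>k\<close>, \<open>l\<close> for elements of \<open>K[d]\<close>. Since \<open>b = k c(k)\<inverse>\<close> lies in \<open>K[c]\<close> and the Peiffer element
  \<open>\<langle>k, l\<rangle>\<close> is the inverse of the group commutator of \<open>c(k) l c(k)\<inverse>\<close> and \<open>b\<close>, the Peiffer commutator is
  the subgroup \<open>P\<close> generated by \<open>[K[d] \<and> M, K[c] \<and> N]\<close> and \<open>[K[d] \<and> N, K[c] \<and> M]\<close>. It is an ideal
  of \<open>A\<close> on which \<open>d\<close> and \<open>c\<close> are trivial. The term \<open>[x d(x)\<inverse>, y c(y)\<inverse>]\<close> of \<open>W\<close> shows that \<open>P\<close> is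
  contained in the relative commutator.

  For the converse one passes to \<open>A / P\<close>, where both sets of commutators become trivial. There
  \<open>[k r, l s] = [k, l] [r, s]\<close> for \<open>k, l\<close> in \<open>M\<close> and \<open>r, s\<close> in \<open>N\<close> with \<open>k, r\<close> in \<open>K[d]\<close> and \<open>l, s\<close> in \<open>K[c]\<close>,
  and \<open>[k, l]\<close> centralises \<open>N\<close>. Hence in the algebra of the triples \<open>(q, m, n)\<close> with \<open>q\<close> congruent to
  \<open>m\<close> modulo \<open>N\<close> and to \<open>n\<close> modulo \<open>M\<close>, the commutators of \<open>K[d]\<close> and \<open>K[c]\<close> lie in an ideal all of whose
  elements have the form \<open>(x y, x, y)\<close>. Every \<open>v\<close> in \<open>W\<close> takes its values in that ideal, and evaluating
  it at \<open>(m n, m, n)\<close> gives \<open>v(m n) = v(m) v(n)\<close>.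
\<close>

section \<open>Algebras of PXM and their ideals\<close>

lemma omega_hom_pxm_iff:
  fixes A :: "('a, pxm_op) omega_struct" and B :: "('b, pxm_op) omega_struct"
  shows "h \<in> omega_hom A B \<longleftrightarrow>
    h \<in> hom A B \<and> (\<forall>f. \<forall>x \<in> carrier A. h (oper A f [x]) = oper B f [h x])"
  by (auto simp: omega_hom_def arity_pxm_op_def length_Suc_conv)

lemma omega_closed_pxm_iff:
  fixes A :: "('a, pxm_op) omega_struct"
  shows "omega_closed A S \<longleftrightarrow> (\<forall>f. \<forall>x \<in> S. oper A f [x] \<in> S)"
  by (auto simp: omega_closed_def arity_pxm_op_def length_Suc_conv)

text \<open>All four composition laws say that every operation fixes the values of every operation.
  This form treats \<open>Dom\<close> and \<open>Cod\<close> uniformly; preservation of the unit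
  comes from the endomorphism property.\<close>

lemma PXM_iff:
  "PXM A \<longleftrightarrow> group A \<and> (\<forall>f. (\<lambda>x. oper A f [x]) \<in> hom A A) \<and>
     (\<forall>f g. \<forall>x \<in> carrier A. oper A f [oper A g [x]] = oper A g [x])"
  (is "?L \<longleftrightarrow> ?R")
proof
  assume A: ?L
  have "(\<lambda>x. oper A f [x]) \<in> hom A A" for f
    using PXM_facts(2,3)[OF A] by (cases f) (auto simp: group_hom_def group_hom_axioms_def)
  then show ?R using PXM_facts(1,5)[OF A] by blast
next
  assume R: ?R
  then have hom: "group_hom A A (\<lambda>x. oper A f [x])" for f
    by (simp add: group_hom_def group_hom_axioms_def)
  show ?L
    using R group_hom.hom_one[OF hom] group_hom.hom_mult[OF hom] group_hom.hom_closed[OF hom]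
    by (auto simp: PXM_def omega_group_def omega_closed_pxm_iff arity_pxm_op_def)
qed

locale pxm = fixes A :: "('a, pxm_op) omega_struct" (structure)
  assumes PXM: "PXM A"
begin

sublocale group A
  using PXM PXM_facts(1) by blast

abbreviation opr :: "pxm_op \<Rightarrow> 'a \<Rightarrow> 'a" where "opr f x \<equiv> oper A f [x]"
abbreviation ker :: "pxm_op \<Rightarrow> 'a set" where "ker f \<equiv> kernel A A (opr f)"

lemma op_hom: "group_hom A A (opr f)"
  using PXM by (simp add: PXM_iff group_hom_def group_hom_axioms_def is_group)

lemmas op_simps [simp] =
  group_hom.hom_closed[OF op_hom] group_hom.hom_one[OF op_hom]
  group_hom.hom_mult[OF op_hom] group_hom.hom_inv[OF op_hom] PXM_facts(5)[OF PXM]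

lemma ker_normal: "ker f \<lhd> A"
  using group_hom.normal_kernel[OF op_hom] .

lemma mem_ker: "x \<in> ker f \<longleftrightarrow> x \<in> carrier A \<and> opr f x = \<one>"
  by (auto simp: kernel_def)

text \<open>The operations are group endomorphisms, so closure of \<open>M\<close> under them is
  exactly what makes them well defined on cosets.\<close>

lemma quotient:
  assumes M: "M \<lhd> A" and cl: "\<And>f x. x \<in> M \<Longrightarrow> opr f x \<in> M"
  obtains B :: "('a set, pxm_op) omega_struct" and h
  where "PXM B" "h \<in> omega_hom A B" "h ` carrier A = carrier B" "kernel A B h = M"
proof -
  interpret M: normal M A by fact
  define h where "h x = M #> x" for x
  \<comment> \<open>An operation acts on a coset through a chosen representative. Only the head of
    the argument list matters, as all operations are unary.\<close>
  define B where "B = \<lparr>carrier = rcosets M, mult = (<#>), one = M,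
    oper = (\<lambda>f xs. h (opr f (SOME x. x \<in> carrier A \<and> h x = hd xs)))\<rparr>"
  have "group B"
    using M.factorgroup_is_group
    by (auto simp: B_def FactGroup_def group_def monoid_def group_axioms_def Units_def)
  have hB: "h x \<in> carrier B" if "x \<in> carrier A" for x
    using that by (auto simp: h_def B_def RCOSETS_def)
  have hmult: "h (x \<otimes> y) = h x \<otimes>\<^bsub>B\<^esub> h y" if "x \<in> carrier A" "y \<in> carrier A" for x y
    using that by (simp add: h_def B_def M.rcos_sum)
  have hhom: "h \<in> hom A B" using hB hmult by (auto simp: hom_def)
  have surj: "h ` carrier A = carrier B"
    by (auto simp: h_def B_def RCOSETS_def)
  have ker: "kernel A B h = M"
    using M.subset coset_join1[OF _ _ M.subgroup_axioms] coset_join2[OF _ M.subgroup_axioms]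
    by (auto simp: kernel_def h_def B_def)
  interpret h: group_hom A B h
    by (simp add: group_hom_def group_hom_axioms_def is_group \<open>group B\<close> hhom)
  have op: "h (opr f x) = oper B f [h x]" if x: "x \<in> carrier A" for f x
  proof -
    define y where "y = (SOME y. y \<in> carrier A \<and> h y = h x)"
    have y: "y \<in> carrier A" "h y = h x"
      unfolding y_def using someI[of "\<lambda>y. y \<in> carrier A \<and> h y = h x" x] x by auto
    \<comment> \<open>The chosen representative \<open>y\<close> and \<open>x\<close> differ by an
      element of \<open>M\<close>, which the operation keeps in \<open>M\<close>.\<close>
    then have "y \<otimes> inv x \<in> kernel A B h" using x by (simp add: kernel_def)
    then have "opr f (y \<otimes> inv x) \<in> kernel A B h" using cl ker by simp
    then have "h (opr f y) = h (opr f x)"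
      using x y h.H.inv_equality[of "h (opr f y)" "inv\<^bsub>B\<^esub> h (opr f x)"] by (simp add: kernel_def)
    then show ?thesis by (simp add: B_def y_def)
  qed
  have "oper B f [x] \<in> carrier B \<and> oper B f [oper B g [x]] = oper B g [x]" if "x \<in> carrier B" for f g x
  proof -
    from that obtain a where "a \<in> carrier A" "x = h a" using surj by auto
    then show ?thesis by (simp flip: op)
  qed
  moreover have "oper B f [x \<otimes>\<^bsub>B\<^esub> y] = oper B f [x] \<otimes>\<^bsub>B\<^esub> oper B f [y]"
    if "x \<in> carrier B" "y \<in> carrier B" for f x y
  proof -
    from that obtain a b where "a \<in> carrier A" "x = h a" "b \<in> carrier A" "y = h b"
      using surj by (metis imageE)
    then show ?thesis by (simp flip: op h.hom_mult)
  qed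
  ultimately have "PXM B"
    using \<open>group B\<close> by (simp add: PXM_iff hom_def)
  then show thesis
    using that[of B h] op hhom surj ker by (simp add: omega_hom_pxm_iff)
qed

text \<open>Replaces the existence of a homomorphism by closure conditions that can be checked. The
  converse direction uses the projection onto the quotient.\<close>

lemma omega_ideal_iff:
  "omega_ideal PXM A M \<longleftrightarrow> M \<lhd> A \<and> (\<forall>f. \<forall>x \<in> M. opr f x \<in> M)"
proof
  assume M: "omega_ideal PXM A M"
  then obtain B :: "('a set, pxm_op) omega_struct" and h
    where B: "PXM B" "h \<in> omega_hom A B" "M = kernel A B h"
    unfolding omega_ideal_def by blast
  interpret h: group_hom A B h
    using B PXM_facts(1) is_group by (auto simp: group_hom_def group_hom_axioms_def omega_hom_def)
  show "M \<lhd> A \<and> (\<forall>f. \<forall>x \<in> M. opr f x \<in> M)"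
    using M h.normal_kernel B(3) by (auto simp: omega_ideal_def omega_subalgebra_def omega_closed_pxm_iff)
next
  assume M: "M \<lhd> A \<and> (\<forall>f. \<forall>x \<in> M. opr f x \<in> M)"
  then obtain B :: "('a set, pxm_op) omega_struct" and h
    where "PXM B" "h \<in> omega_hom A B" "kernel A B h = M"
    using quotient[of M] by metis
  then show "omega_ideal PXM A M"
    using omega_ideal_kernel[OF PXM] by metis
qed

lemma omega_ideal_subalgebra:
  assumes "omega_ideal PXM A I" "omega_subalgebra S A" "I \<subseteq> S"
  shows "omega_ideal PXM (A\<lparr>carrier := S\<rparr>) I"
proof -
  interpret S: pxm "A\<lparr>carrier := S\<rparr>"
    using omega_subalgebra_PXM[OF PXM assms(2)] by unfold_locales
  show ?thesis
    using assms normal_restrict_supergroup[of S I]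
    by (auto simp: omega_ideal_iff S.omega_ideal_iff omega_subalgebra_def)
qed

lemma eval_subalgebra:
  assumes S: "omega_subalgebra S A" and v: "wf_term v" and x: "range x \<subseteq> S"
  shows "eval (A\<lparr>carrier := S\<rparr>) v x = eval A v x"
proof -
  have S': "PXM (A\<lparr>carrier := S\<rparr>)" using omega_subalgebra_PXM[OF PXM S] .
  have "S \<subseteq> carrier A" using S by (simp add: omega_subalgebra_def subgroup_def)
  then have "id \<in> omega_hom (A\<lparr>carrier := S\<rparr>) A"
    by (auto simp: omega_hom_def hom_def)
  then show ?thesis
    using eval_omega_hom[of "A\<lparr>carrier := S\<rparr>" A id v x] S' PXM v x by (simp add: PXM_def)
qed

section \<open>Commutators, crossed modules and values of vanishing terms\<close>

definition comm :: "'a \<Rightarrow> 'a \<Rightarrow> 'a" where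
  "comm x y = x \<otimes> y \<otimes> inv x \<otimes> inv y"

lemma comm_closed [simp]: "x \<in> carrier A \<Longrightarrow> y \<in> carrier A \<Longrightarrow> comm x y \<in> carrier A"
  by (simp add: comm_def)

lemma comm_eq_one_iff:
  assumes "x \<in> carrier A" "y \<in> carrier A"
  shows "comm x y = \<one> \<longleftrightarrow> x \<otimes> y = y \<otimes> x"
proof -
  have "comm x y = (x \<otimes> y) \<otimes> inv (y \<otimes> x)"
    using assms by (simp add: comm_def inv_mult_group m_assoc)
  then show ?thesis
    using assms by (metis inv_equality inv_inv inv_closed m_closed r_inv)
qed

lemma XM_iff: "XM A \<longleftrightarrow> (\<forall>x \<in> ker Dom. \<forall>y \<in> ker Cod. comm x y = \<one>)"
  using group_commutator_trivial[of "ker Dom" "ker Cod"] PXM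
  by (auto simp: XM_def comm_def mem_ker subset_iff)

text \<open>An arbitrary preimage \<open>a\<close> is corrected to
  \<open>a \<otimes> inv (opr f a)\<close>. Idempotence of \<open>f\<close> puts this into
  \<open>ker f\<close>, and the image stays \<open>b\<close> because \<open>opr f a\<close> is sent
  to the unit.\<close>

lemma ker_lift:
  assumes B: "PXM B" and h: "h \<in> omega_hom A B" and S: "omega_subalgebra S A"
    and b: "b \<in> h ` S" "oper B f [b] = \<one>\<^bsub>B\<^esub>"
  obtains a where "a \<in> S" "a \<in> ker f" "h a = b"
proof -
  interpret B: pxm B by unfold_locales fact
  interpret h: group_hom A B h
    using h by unfold_locales (simp add: omega_hom_def)
  interpret S: subgroup S A using S by (simp add: omega_subalgebra_def)
  obtain a where a: "a \<in> S" "b = h a" using b by blast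
  have op: "h (opr f a) = B.opr f (h a)"
    using h a by (simp add: omega_hom_pxm_iff)
  have "opr f a \<in> S" using S a by (simp add: omega_subalgebra_def omega_closed_pxm_iff)
  then have "a \<otimes> inv (opr f a) \<in> S" "a \<otimes> inv (opr f a) \<in> ker f" "h (a \<otimes> inv (opr f a)) = b"
    using a b op by (auto simp: mem_ker)
  then show thesis by (rule that)
qed

lemma carrier_subalgebra: "omega_subalgebra (carrier A) A"
  by (simp add: omega_subalgebra_def omega_closed_pxm_iff subgroup_self)

text \<open>Elements of the two kernels lift along the projection to A / Z, so the hypothesis on
  commutators makes the quotient a crossed module, where \<open>v\<close> vanishes.\<close>

lemma eval_vanishing_in_ideal:
  assumes Z: "omega_ideal PXM A Z" and v: "v \<in> vanishing_terms XM" and x: "range x \<subseteq> carrier A"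
    and comm: "\<And>a b. a \<in> ker Dom \<Longrightarrow> b \<in> ker Cod \<Longrightarrow> comm a b \<in> Z"
  shows "eval A v x \<in> Z"
proof -
  obtain B :: "('a set, pxm_op) omega_struct" and h
    where B: "PXM B" "h \<in> omega_hom A B" "h ` carrier A = carrier B" "kernel A B h = Z"
    using Z quotient[of Z] unfolding omega_ideal_iff by metis
  interpret B: pxm B using B by unfold_locales
  interpret h: group_hom A B h
    using B by unfold_locales (simp add: omega_hom_def)
  have "XM B"
    unfolding B.XM_iff
  proof (intro ballI)
    fix a b assume "a \<in> B.ker Dom" "b \<in> B.ker Cod"
    then have ab: "a \<in> h ` carrier A" "B.opr Dom a = \<one>\<^bsub>B\<^esub>" "b \<in> h ` carrier A" "B.opr Cod b = \<one>\<^bsub>B\<^esub>"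
      using B(3) by (auto simp: B.mem_ker)
    obtain a' where "a' \<in> ker Dom" "h a' = a"
      by (rule ker_lift[OF B(1,2) carrier_subalgebra ab(1,2)])
    moreover obtain b' where "b' \<in> ker Cod" "h b' = b"
      by (rule ker_lift[OF B(1,2) carrier_subalgebra ab(3,4)])
    ultimately have *: "a' \<in> ker Dom" "h a' = a" "b' \<in> ker Cod" "h b' = b"
      by simp_all
    then have "h (comm a' b') = \<one>\<^bsub>B\<^esub>" using comm B(4) by (auto simp: kernel_def)
    then show "B.comm a b = \<one>\<^bsub>B\<^esub>"
      using * by (auto simp: comm_def B.comm_def mem_ker)
  qed
  moreover have "range (h \<circ> x) \<subseteq> carrier B" using x by auto
  ultimately have "eval B v (h \<circ> x) = \<one>\<^bsub>B\<^esub>"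
    using vanishing_terms_XM[OF v] by blast
  moreover have "eval A v x \<in> carrier A \<and> h (eval A v x) = eval B v (h \<circ> x)"
    using eval_omega_hom[OF _ _ B(2) _ x] v B(1) PXM by (simp add: PXM_def vanishing_terms_def)
  ultimately show ?thesis using B(4) by (auto simp: kernel_def)
qed

end

section \<open>Binary products of algebras\<close>

definition omega_prod ::
  "('a, 'f) omega_struct \<Rightarrow> ('b, 'f) omega_struct \<Rightarrow> ('a \<times> 'b, 'f) omega_struct" where
  "omega_prod A B = \<lparr>carrier = carrier A \<times> carrier B,
     mult = (\<lambda>(a, b) (a', b'). (a \<otimes>\<^bsub>A\<^esub> a', b \<otimes>\<^bsub>B\<^esub> b')), one = (\<one>\<^bsub>A\<^esub>, \<one>\<^bsub>B\<^esub>),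
     oper = (\<lambda>f xs. (oper A f (map fst xs), oper B f (map snd xs)))\<rparr>"

lemma omega_prod_simps [simp]:
  "carrier (omega_prod A B) = carrier A \<times> carrier B"
  "(a, b) \<otimes>\<^bsub>omega_prod A B\<^esub> (a', b') = (a \<otimes>\<^bsub>A\<^esub> a', b \<otimes>\<^bsub>B\<^esub> b')"
  "\<one>\<^bsub>omega_prod A B\<^esub> = (\<one>\<^bsub>A\<^esub>, \<one>\<^bsub>B\<^esub>)"
  "oper (omega_prod A B) f [(a, b)] = (oper A f [a], oper B f [b])"
  by (simp_all add: omega_prod_def)

lemma
  assumes "group A" "group B"
  shows group_omega_prod: "group (omega_prod A B)"
    and inv_omega_prod:
      "a \<in> carrier A \<Longrightarrow> b \<in> carrier B \<Longrightarrow> inv\<^bsub>omega_prod A B\<^esub> (a, b) = (inv\<^bsub>A\<^esub> a, inv\<^bsub>B\<^esub> b)"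
proof -
  interpret A: group A by fact
  interpret B: group B by fact
  show *: "group (omega_prod A B)"
    by (rule groupI) (auto simp: A.m_assoc B.m_assoc intro: A.l_inv_ex B.l_inv_ex)
  show "a \<in> carrier A \<Longrightarrow> b \<in> carrier B \<Longrightarrow> inv\<^bsub>omega_prod A B\<^esub> (a, b) = (inv\<^bsub>A\<^esub> a, inv\<^bsub>B\<^esub> b)"
    by (rule group.inv_equality[OF *]) auto
qed

lemma PXM_omega_prod:
  assumes "PXM A" "PXM B"
  shows "PXM (omega_prod A B)"
  using assms group_omega_prod[of A B] by (auto simp: PXM_iff hom_def Pi_iff)

section \<open>Commutator calculus\<close>

context group
begin

lemma inv_cancel_left:
  assumes "x \<in> carrier G" "y \<in> carrier G"
  shows "x \<otimes> (inv x \<otimes> y) = y" "inv x \<otimes> (x \<otimes> y) = y"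
  using assms by (simp_all flip: m_assoc)

lemma commute_inv:
  assumes "x \<in> carrier G" "y \<in> carrier G" "x \<otimes> y = y \<otimes> x"
  shows "inv x \<otimes> y = y \<otimes> inv x"
  using assms by (metis inv_closed inv_solve_left inv_solve_right m_assoc m_closed)

end

context pxm
begin

lemma comm_in_normal:
  assumes "H \<lhd> A" "x \<in> carrier A" "y \<in> carrier A" "x \<in> H \<or> y \<in> H"
  shows "comm x y \<in> H"
proof -
  interpret H: normal H A by fact
  have "comm x y = x \<otimes> (y \<otimes> inv x \<otimes> inv y)" "comm x y = (x \<otimes> y \<otimes> inv x) \<otimes> inv y"
    using assms by (simp_all add: comm_def m_assoc)
  then show ?thesis
    using assms H.inv_op_closed2[of y "inv x"] H.inv_op_closed2[of x y]
    by (metis H.m_closed H.m_inv_closed)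
qed

lemma conj_comm:
  assumes "g \<in> carrier A" "x \<in> carrier A" "y \<in> carrier A"
  shows "g \<otimes> comm x y \<otimes> inv g = comm (g \<otimes> x \<otimes> inv g) (g \<otimes> y \<otimes> inv g)"
  using assms by (simp add: comm_def inv_mult_group m_assoc inv_cancel_left)

text \<open>Moving \<open>r\<close> past \<open>l\<close> and \<open>inv k\<close> past
  \<open>inv s\<close> brings the factors of \<open>comm r s\<close> together; that block then moves
  past \<open>inv k\<close> and \<open>inv l\<close>.\<close>

lemma comm_mult:
  assumes [simp]: "k \<in> carrier A" "l \<in> carrier A" "r \<in> carrier A" "s \<in> carrier A"
    and "l \<otimes> r = r \<otimes> l" "k \<otimes> s = s \<otimes> k"
    and "k \<otimes> comm r s = comm r s \<otimes> k" "l \<otimes> comm r s = comm r s \<otimes> l"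
  shows "comm (k \<otimes> r) (l \<otimes> s) = comm k l \<otimes> comm r s"
proof -
  have ks: "inv k \<otimes> inv s = inv s \<otimes> inv k"
    using assms by (metis inv_mult_group)
  have "comm (k \<otimes> r) (l \<otimes> s) = k \<otimes> (r \<otimes> l) \<otimes> s \<otimes> inv r \<otimes> (inv k \<otimes> inv s) \<otimes> inv l"
    by (simp add: comm_def inv_mult_group m_assoc)
  also have "\<dots> = k \<otimes> l \<otimes> (comm r s \<otimes> inv k) \<otimes> inv l"
    unfolding ks assms(5)[symmetric] by (simp add: comm_def m_assoc)
  also have "comm r s \<otimes> inv k = inv k \<otimes> comm r s"
    using commute_inv[OF _ _ assms(7)] by simp
  also have "k \<otimes> l \<otimes> (inv k \<otimes> comm r s) \<otimes> inv l = k \<otimes> l \<otimes> inv k \<otimes> (comm r s \<otimes> inv l)"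
    by (simp add: m_assoc)
  also have "comm r s \<otimes> inv l = inv l \<otimes> comm r s"
    using commute_inv[OF _ _ assms(8)] by simp
  also have "k \<otimes> l \<otimes> inv k \<otimes> (inv l \<otimes> comm r s) = comm k l \<otimes> comm r s"
    by (simp add: comm_def[of k l] m_assoc)
  finally show ?thesis .
qed

text \<open>Serves as the target for commutators from one ideal. Since both operations are trivial
  here, closure under them is immediate for the ideal \<open>Z\<close> in
  \<open>eval_mult\<close>.\<close>

definition central :: "'a set \<Rightarrow> 'a set \<Rightarrow> 'a set" where
  "central H L = {x \<in> H. (\<forall>f. opr f x = \<one>) \<and> (\<forall>n \<in> L. n \<otimes> x = x \<otimes> n)}"

lemma central_normal:
  assumes "H \<lhd> A" "L \<lhd> A"
  shows "central H L \<lhd> A"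
proof -
  interpret H: normal H A by fact
  interpret L: normal L A by fact
  have "subgroup (central H L) A"
  proof (rule subgroupI)
    have "\<one> \<in> central H L" by (auto simp: central_def)
    then show "central H L \<noteq> {}" by auto
    fix x assume x: "x \<in> central H L"
    then show "inv x \<in> central H L"
      by (auto simp: central_def commute_inv)
    fix y assume "y \<in> central H L"
    then show "x \<otimes> y \<in> central H L"
      using x by (auto simp: central_def) (metis H.mem_carrier L.mem_carrier m_assoc)
  qed (auto simp: central_def)
  moreover have "g \<otimes> x \<otimes> inv g \<in> central H L" if g: "g \<in> carrier A" and x: "x \<in> central H L" for g x
  proof -
    have xc: "x \<in> carrier A" and "x \<in> H" using x by (auto simp: central_def)
    have "n \<otimes> (g \<otimes> x \<otimes> inv g) = (g \<otimes> x \<otimes> inv g) \<otimes> n" if n: "n \<in> L" for n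
    proof -
      \<comment> \<open>Commuting \<open>n\<close> with a conjugate of \<open>x\<close> amounts to
        commuting a conjugate of \<open>n\<close> with \<open>x\<close>, and \<open>L\<close> is
        stable under conjugation.\<close>
      have "n \<otimes> (g \<otimes> x \<otimes> inv g) = g \<otimes> ((inv g \<otimes> n \<otimes> g) \<otimes> x) \<otimes> inv g"
        using g n xc by (simp add: m_assoc inv_cancel_left)
      also have "(inv g \<otimes> n \<otimes> g) \<otimes> x = x \<otimes> (inv g \<otimes> n \<otimes> g)"
        using x L.inv_op_closed1[OF g n] by (simp add: central_def)
      finally show ?thesis
        using g n xc by (simp add: m_assoc inv_cancel_left)
    qed
    then show ?thesis
      using x g xc H.inv_op_closed2[OF g \<open>x \<in> H\<close>] by (auto simp: central_def)
  qed
  ultimately show ?thesis by (simp add: normal_inv_iff)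
qed

end

section \<open>Ideals with trivial Peiffer commutator\<close>

text \<open>The situation reached after dividing by \<open>peiffer_ideal M N\<close>.\<close>

locale commuting_ideals = pxm +
  fixes M N
  assumes ideals: "omega_ideal PXM A M" "omega_ideal PXM A N"
    and commute: "\<And>a b. a \<in> ker Dom \<Longrightarrow> b \<in> ker Cod \<Longrightarrow> a \<in> M \<and> b \<in> N \<or> a \<in> N \<and> b \<in> M \<Longrightarrow>
      a \<otimes> b = b \<otimes> a"
begin

lemma commuting_ideals_swap: "commuting_ideals A N M"
  using ideals commute by unfold_locales auto

lemma normals: "M \<lhd> A" "N \<lhd> A" and op_closed: "x \<in> M \<Longrightarrow> opr f x \<in> M" "x \<in> N \<Longrightarrow> opr f x \<in> N"
  using ideals by (auto simp: omega_ideal_iff)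

sublocale M: normal M A by (rule normals)
sublocale N: normal N A by (rule normals)
sublocale ker: normal "ker f" A for f by (rule ker_normal)

text \<open>As \<open>comm r s\<close> lies in both kernels and in \<open>N\<close>, it commutes
  with \<open>k\<close> in the role of an element of \<open>ker Cod\<close> and with
  \<open>l\<close> in the role of an element of \<open>ker Dom\<close>.\<close>

lemma comm_mult_ideals:
  assumes "k \<in> ker Dom" "k \<in> M" "l \<in> ker Cod" "l \<in> M" "r \<in> ker Dom" "r \<in> N" "s \<in> ker Cod" "s \<in> N"
  shows "comm (k \<otimes> r) (l \<otimes> s) = comm k l \<otimes> comm r s"
proof -
  have "comm r s \<in> ker f" for f
    using comm_in_normal[OF ker_normal] assms by (cases f) auto
  moreover have "comm r s \<in> N"
    using comm_in_normal[OF normals(2)] assms by auto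
  ultimately show ?thesis
    using assms commute by (intro comm_mult) (auto simp: ker.mem_carrier)
qed

text \<open>Splits \<open>k'\<close> as \<open>k\<close> times an element of \<open>N\<close>, and
  likewise \<open>l'\<close>.\<close>

lemma comm_cong_mod:
  assumes "k \<in> ker Dom" "k \<in> M" "k' \<in> ker Dom" "inv k \<otimes> k' \<in> N"
    and "l \<in> ker Cod" "l \<in> M" "l' \<in> ker Cod" "inv l \<otimes> l' \<in> N"
  shows "comm k' l' = comm k l \<otimes> comm (inv k \<otimes> k') (inv l \<otimes> l')"
  using comm_mult_ideals[of k l "inv k \<otimes> k'" "inv l \<otimes> l'"] assms
  by (simp add: ker.mem_carrier inv_cancel_left)

text \<open>Here the correcting factors lie in both ideals, so they commute with each other and
  contribute nothing.\<close>

lemma comm_eq_mod: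
  assumes "k \<in> ker Dom" "k \<in> M" "k' \<in> ker Dom" "k' \<in> M" "inv k \<otimes> k' \<in> N"
    and "l \<in> ker Cod" "l \<in> M" "l' \<in> ker Cod" "l' \<in> M" "inv l \<otimes> l' \<in> N"
  shows "comm k' l' = comm k l"
proof -
  have "comm (inv k \<otimes> k') (inv l \<otimes> l') = \<one>"
    using assms commute[of "inv k \<otimes> k'" "inv l \<otimes> l'"]
    by (subst comm_eq_one_iff) (auto simp: ker.mem_carrier)
  then show ?thesis
    using comm_cong_mod[of k k' l l'] assms by (simp add: ker.mem_carrier)
qed

text \<open>Conjugation by \<open>n\<close> changes \<open>k\<close> and \<open>l\<close> only
  modulo \<open>N\<close> and keeps them in \<open>M\<close> and in their kernels, so their
  commutator is unchanged by \<open>comm_eq_mod\<close>.\<close>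

lemma comm_centralises:
  assumes k: "k \<in> ker Dom" "k \<in> M" and l: "l \<in> ker Cod" "l \<in> M" and n: "n \<in> N"
  shows "n \<otimes> comm k l = comm k l \<otimes> n"
proof -
  have conj: "inv x \<otimes> (n \<otimes> x \<otimes> inv n) \<in> N" if "x \<in> carrier A" for x
  proof -
    have "inv x \<otimes> (n \<otimes> x \<otimes> inv n) = (inv x \<otimes> n \<otimes> x) \<otimes> inv n"
      using that n by (simp add: m_assoc)
    then show ?thesis using N.inv_op_closed1[OF that n] n by simp
  qed
  have "n \<otimes> comm k l \<otimes> inv n = comm k l"
    using k l n conj
    by (subst conj_comm) (auto simp: ker.mem_carrier ker.inv_op_closed2 M.inv_op_closed2 intro!: comm_eq_mod)
  then show ?thesis
    using k l n by (simp add: ker.mem_carrier inv_solve_right')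
qed

end

section \<open>Values of vanishing terms on commuting ideals\<close>

lemma eval_omega_prod:
  fixes x :: "nat \<Rightarrow> 'a \<times> 'b" and A :: "('a, 'f::signature) omega_struct"
  assumes "omega_group A" "omega_group B" "omega_group (omega_prod A B)"
    and v: "wf_term v" and x: "range x \<subseteq> carrier (omega_prod A B)"
  shows "eval (omega_prod A B) v x = (eval A v (fst \<circ> x), eval B v (snd \<circ> x))"
proof -
  have "fst \<in> omega_hom (omega_prod A B) A" "snd \<in> omega_hom (omega_prod A B) B"
    by (auto simp: omega_hom_def hom_def omega_prod_def)
  then show ?thesis
    using eval_omega_hom[OF assms(3,1) _ v x, of fst] eval_omega_hom[OF assms(3,2) _ v x, of snd]
    by (simp add: prod_eq_iff)
qed

context commuting_ideals
begin

text \<open>The intersection is itself a crossed module, since its elements can be read in either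
  ideal.\<close>

lemma eval_inter:
  assumes v: "v \<in> vanishing_terms XM" and p: "range p \<subseteq> M \<inter> N"
  shows "eval A v p = \<one>"
proof -
  have S: "omega_subalgebra (M \<inter> N) A"
    using subgroups_Inter_pair[OF M.subgroup_axioms N.subgroup_axioms] op_closed
    by (auto simp: omega_subalgebra_def omega_closed_pxm_iff)
  interpret S: pxm "A\<lparr>carrier := M \<inter> N\<rparr>"
    using omega_subalgebra_PXM[OF PXM S] by unfold_locales
  have "XM (A\<lparr>carrier := M \<inter> N\<rparr>)"
    unfolding S.XM_iff S.comm_eq_one_iff
  proof (intro ballI)
    fix x y assume xy: "x \<in> S.ker Dom" "y \<in> S.ker Cod"
    then have *: "x \<in> M \<inter> N" "y \<in> M \<inter> N" "opr Dom x = \<one>" "opr Cod y = \<one>"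
      unfolding S.mem_ker by simp_all
    then have "x \<otimes> y = y \<otimes> x"
      using commute[of x y] by (auto simp: mem_ker)
    then show "S.comm x y = \<one>\<^bsub>A\<lparr>carrier := M \<inter> N\<rparr>\<^esub>"
      using * by (subst S.comm_eq_one_iff) simp_all
  qed
  then have "eval (A\<lparr>carrier := M \<inter> N\<rparr>) v p = \<one>"
    using vanishing_terms_XM[OF v, of "A\<lparr>carrier := M \<inter> N\<rparr>"] p by simp
  then show ?thesis
    using eval_subalgebra[OF S _ p] v by (simp add: vanishing_terms_def)
qed

lemma eval_mult:
  assumes v: "v \<in> vanishing_terms XM" and m: "range m \<subseteq> M" and n: "range n \<subseteq> N"
  shows "eval A v (\<lambda>i. m i \<otimes> n i) = eval A v m \<otimes> eval A v n"
proof -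
  interpret sw: commuting_ideals A N M by (rule commuting_ideals_swap)
  \<comment> \<open>The quotients by \<open>M\<close> and by \<open>N\<close> serve to express
    congruences as equations: \<open>g\<close> for congruence modulo \<open>M\<close>,
    \<open>h\<close> for congruence modulo \<open>N\<close>.\<close>
  obtain B :: "('a set, pxm_op) omega_struct" and g
    where B: "PXM B" "g \<in> omega_hom A B" "kernel A B g = M"
    by (rule quotient[OF normals(1) op_closed(1)])
  obtain C :: "('a set, pxm_op) omega_struct" and h
    where C: "PXM C" "h \<in> omega_hom A C" "kernel A C h = N"
    by (rule quotient[OF normals(2) op_closed(2)])
  interpret g: group_hom A B g
    using B PXM_facts(1) is_group by (simp add: group_hom_def group_hom_axioms_def omega_hom_def)
  interpret h: group_hom A C h
    using C PXM_facts(1) is_group by (simp add: group_hom_def group_hom_axioms_def omega_hom_def)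
  have op: "g (opr f x) = oper B f [g x]" "h (opr f x) = oper C f [h x]" if "x \<in> carrier A" for f x
    using B(2) C(2) that by (auto simp: omega_hom_pxm_iff)
  have g_one: "x \<in> M \<Longrightarrow> g x = \<one>\<^bsub>B\<^esub>" and M_I: "x \<in> carrier A \<Longrightarrow> g x = \<one>\<^bsub>B\<^esub> \<Longrightarrow> x \<in> M" for x
    unfolding B(3)[symmetric] kernel_def by blast+
  have h_one: "x \<in> N \<Longrightarrow> h x = \<one>\<^bsub>C\<^esub>" and N_I: "x \<in> carrier A \<Longrightarrow> h x = \<one>\<^bsub>C\<^esub> \<Longrightarrow> x \<in> N" for x
    unfolding C(3)[symmetric] kernel_def by blast+
  define P where "P = omega_prod A (omega_prod A A)"
  have "PXM P" using PXM by (simp add: P_def PXM_omega_prod)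
  interpret P: pxm P by unfold_locales fact
  have P_simps [simp]: "carrier P = carrier A \<times> carrier A \<times> carrier A" "\<one>\<^bsub>P\<^esub> = (\<one>, \<one>, \<one>)"
    "(q, a, b) \<otimes>\<^bsub>P\<^esub> (q', a', b') = (q \<otimes> q', a \<otimes> a', b \<otimes> b')"
    "oper P f [(q, a, b)] = (opr f q, opr f a, opr f b)" for q a b q' a' b' f
    by (simp_all add: P_def)
  have P_inv [simp]: "inv\<^bsub>P\<^esub> (q, a, b) = (inv q, inv a, inv b)"
    if "q \<in> carrier A" "a \<in> carrier A" "b \<in> carrier A" for q a b
    using that by (simp add: P_def inv_omega_prod group_omega_prod is_group)
  define T where "T = {(q, a, b). q \<in> carrier A \<and> a \<in> M \<and> b \<in> N \<and> h q = h a \<and> g q = g b}"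
  have "(\<one>, \<one>, \<one>) \<in> T" by (auto simp: T_def)
  then have "T \<noteq> {}" by blast
  then have "subgroup T P"
    by (intro P.subgroupI) (auto simp: T_def)
  then have T: "omega_subalgebra T P"
    by (auto simp: omega_subalgebra_def omega_closed_pxm_iff T_def op op_closed)
  interpret T: subgroup T P by fact
  define T' where "T' = P\<lparr>carrier := T\<rparr>"
  interpret T': pxm T'
    unfolding T'_def using omega_subalgebra_PXM[OF \<open>PXM P\<close> T] by unfold_locales
  have inv_T': "inv\<^bsub>T'\<^esub> x = inv\<^bsub>P\<^esub> x" if "x \<in> T" for x
    unfolding T'_def using P.m_inv_consistent[OF \<open>subgroup T P\<close> that] .
  define X where "X = central M N"
  define Y where "Y = central N M"
  \<comment> \<open>\<open>X\<close> and \<open>Y\<close> commute elementwise, since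
    \<open>Y\<close> lies in \<open>N\<close>, which \<open>X\<close> centralises. Hence these
    triples form a subgroup.\<close>
  define Z where "Z = {(x \<otimes> y, x, y) | x y. x \<in> X \<and> y \<in> Y}"
  have nX: "X \<lhd> A" and nY: "Y \<lhd> A"
    unfolding X_def Y_def using central_normal normals by auto
  interpret X: normal X A by (rule nX)
  interpret Y: normal Y A by (rule nY)
  have X: "x \<in> M" "opr f x = \<one>" "b \<in> N \<Longrightarrow> b \<otimes> x = x \<otimes> b" if "x \<in> X" for x f b
    using that by (auto simp: X_def central_def)
  have Y: "y \<in> N" "opr f y = \<one>" "a \<in> M \<Longrightarrow> a \<otimes> y = y \<otimes> a" if "y \<in> Y" for y f a
    using that by (auto simp: Y_def central_def)
  have XY: "x \<otimes> y = y \<otimes> x" if "x \<in> X" "y \<in> Y" for x y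
    using X(3)[OF that(1) Y(1)[OF that(2)]] by (rule sym)
  have "Z \<subseteq> T"
    using X(1) Y(1) by (auto simp: Z_def T_def g_one h_one)
  have "omega_ideal PXM T' Z"
    unfolding T'.omega_ideal_iff T'.normal_inv_iff
  proof (intro conjI ballI allI)
    have "(\<one> \<otimes> \<one>, \<one>, \<one>) \<in> Z"
      unfolding Z_def using X.one_closed Y.one_closed by blast
    then have "Z \<noteq> {}" by blast
    moreover have "inv\<^bsub>T'\<^esub> z \<in> Z" if z: "z \<in> Z" for z
    proof -
      obtain x y where xy: "z = (x \<otimes> y, x, y)" "x \<in> X" "y \<in> Y" using z by (auto simp: Z_def)
      have "inv\<^bsub>T'\<^esub> z = inv\<^bsub>P\<^esub> z" using inv_T' z \<open>Z \<subseteq> T\<close> by blast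
      also have "\<dots> = (inv x \<otimes> inv y, inv x, inv y)"
        using xy XY[of "inv x" "inv y"] by (simp add: inv_mult_group)
      finally show ?thesis using xy by (auto simp: Z_def)
    qed
    moreover have "z \<otimes>\<^bsub>T'\<^esub> z' \<in> Z" if "z \<in> Z" "z' \<in> Z" for z z'
    proof -
      from that obtain x y x' y' where xy: "z = (x \<otimes> y, x, y)" "x \<in> X" "y \<in> Y"
        "z' = (x' \<otimes> y', x', y')" "x' \<in> X" "y' \<in> Y"
        unfolding Z_def by blast
      have "x \<otimes> y \<otimes> (x' \<otimes> y') = x \<otimes> (y \<otimes> x') \<otimes> y'"
        using xy by (simp add: m_assoc)
      also have "y \<otimes> x' = x' \<otimes> y" using xy XY[of x' y] by simp
      finally have "x \<otimes> y \<otimes> (x' \<otimes> y') = (x \<otimes> x') \<otimes> (y \<otimes> y')"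
        using xy by (simp add: m_assoc)
      then show ?thesis using xy by (auto simp: Z_def T'_def)
    qed
    ultimately show "subgroup Z T'"
      using \<open>Z \<subseteq> T\<close> by (intro T'.subgroupI) (auto simp: T'_def)
    show "t \<otimes>\<^bsub>T'\<^esub> z \<otimes>\<^bsub>T'\<^esub> inv\<^bsub>T'\<^esub> t \<in> Z" if "t \<in> carrier T'" "z \<in> Z" for t z
    proof -
      from that obtain x y q a b where z: "z = (x \<otimes> y, x, y)" "x \<in> X" "y \<in> Y"
        and t: "t = (q, a, b)" "t \<in> T"
        unfolding Z_def T'_def by (cases t) auto
      then have [simp]: "q \<in> carrier A" "a \<in> carrier A" "b \<in> carrier A" by (auto simp: T_def)
      \<comment> \<open>\<open>q\<close> differs from \<open>a\<close> by an element of
        \<open>N\<close>, which centralises \<open>x\<close>, and from \<open>b\<close> by an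
        element of \<open>M\<close>, which centralises \<open>y\<close>. So conjugation by
        \<open>q\<close> acts on \<open>x\<close> as \<open>a\<close> does and on \<open>y\<close>
        as \<open>b\<close> does.\<close>
      define r where "r = inv a \<otimes> q"
      define s where "s = inv b \<otimes> q"
      have r: "r \<in> N" and s: "s \<in> M"
        using t by (auto simp: T_def r_def s_def intro!: M_I N_I)
      have q: "q = a \<otimes> r" "q = b \<otimes> s"
        by (simp_all add: r_def s_def inv_cancel_left)
      have conj: "u \<otimes> w \<otimes> w' \<otimes> inv (u \<otimes> w) = u \<otimes> w' \<otimes> inv u"
        if "u \<in> carrier A" "w \<in> carrier A" "w' \<in> carrier A" "w \<otimes> w' = w' \<otimes> w" for u w w'
      proof -
        have "u \<otimes> w \<otimes> w' \<otimes> inv (u \<otimes> w) = u \<otimes> (w \<otimes> w') \<otimes> inv w \<otimes> inv u"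
          using that(1-3) by (simp add: inv_mult_group m_assoc)
        then show ?thesis
          unfolding that(4) using that(1-3) by (simp add: m_assoc inv_cancel_left)
      qed
      have "q \<otimes> (x \<otimes> y) \<otimes> inv q = (q \<otimes> x \<otimes> inv q) \<otimes> (q \<otimes> y \<otimes> inv q)"
        using z by (simp add: m_assoc inv_cancel_left)
      also have "q \<otimes> x \<otimes> inv q = a \<otimes> x \<otimes> inv a"
        unfolding q(1) using z r X(3) by (intro conj) auto
      also have "q \<otimes> y \<otimes> inv q = b \<otimes> y \<otimes> inv b"
        unfolding q(2) using z s Y(3) by (intro conj) auto
      finally show ?thesis
        using z t inv_T'[of t] X.inv_op_closed2[of a x] Y.inv_op_closed2[of b y]
        by (auto simp: Z_def T'_def)
    qed
    show "T'.opr f z \<in> Z" if "z \<in> Z" for f z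
      using that by (auto simp: Z_def T'_def X(2) Y(2))
  qed
  moreover have "T'.comm s t \<in> Z" if "s \<in> T'.ker Dom" "t \<in> T'.ker Cod" for s t
  proof -
    obtain q a b q' a' b' where st: "s = (q, a, b)" "t = (q', a', b')"
      by (metis prod_cases3)
    have "s \<in> T" "t \<in> T" "oper P Dom [s] = \<one>\<^bsub>P\<^esub>" "oper P Cod [t] = \<one>\<^bsub>P\<^esub>"
      using that unfolding T'.mem_ker by (simp_all add: T'_def)
    then have s: "s \<in> T" "q \<in> ker Dom" "a \<in> ker Dom" "b \<in> ker Dom"
      and t: "t \<in> T" "q' \<in> ker Cod" "a' \<in> ker Cod" "b' \<in> ker Cod"
      by (auto simp: st T_def mem_ker)
    have T: "q \<in> carrier A" "a \<in> M" "b \<in> N" "h q = h a" "g q = g b"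
      "q' \<in> carrier A" "a' \<in> M" "b' \<in> N" "h q' = h a'" "g q' = g b'"
      using s(1) t(1) by (auto simp: st T_def)
    have "comm q q' = comm a a' \<otimes> comm (inv a \<otimes> q) (inv a' \<otimes> q')"
      using s t T by (intro comm_cong_mod) (auto intro!: N_I)
    \<comment> \<open>Both \<open>inv a \<otimes> q\<close> and \<open>b\<close> lie in
      \<open>N\<close>, and they agree modulo \<open>M\<close> because \<open>a\<close> is in
      \<open>M\<close>; the same holds for the primed elements. The lemma is applied with the ideals
      exchanged.\<close>
    also have "comm (inv a \<otimes> q) (inv a' \<otimes> q') = comm b b'"
      using s t T by (intro sw.comm_eq_mod) (auto simp: g_one intro!: M_I N_I)
    finally have "comm q q' = comm a a' \<otimes> comm b b'" .
    moreover have "comm a a' \<in> X"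
    proof -
      have "comm a a' \<in> ker f" for f
        using comm_in_normal[OF ker_normal] s t by (cases f) (auto simp: mem_ker)
      then show ?thesis
        using comm_in_normal[OF normals(1)] comm_centralises s t T
        by (auto simp: X_def central_def mem_ker)
    qed
    moreover have "comm b b' \<in> Y"
    proof -
      have "comm b b' \<in> ker f" for f
        using comm_in_normal[OF ker_normal] s t by (cases f) (auto simp: mem_ker)
      then show ?thesis
        using comm_in_normal[OF normals(2)] sw.comm_centralises s t T
        by (auto simp: Y_def central_def mem_ker)
    qed
    moreover have "T'.comm s t = (comm q q', comm a a', comm b b')"
      using inv_T' s t T unfolding T'.comm_def comm_def by (simp add: st) (simp add: T'_def)
    ultimately show ?thesis by (auto simp: Z_def)
  qed
  moreover have rg: "range (\<lambda>i. (m i \<otimes> n i, m i, n i)) \<subseteq> T"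
    using m n by (auto simp: T_def image_subset_iff g_one h_one)
  ultimately have "eval T' v (\<lambda>i. (m i \<otimes> n i, m i, n i)) \<in> Z"
    using T'.eval_vanishing_in_ideal[OF _ v] by (simp add: T'_def)
  moreover have "eval T' v (\<lambda>i. (m i \<otimes> n i, m i, n i)) =
    (eval A v (\<lambda>i. m i \<otimes> n i), eval A v m, eval A v n)"
  proof -
    have og: "omega_group A" "omega_group (omega_prod A A)" "omega_group (omega_prod A (omega_prod A A))"
      using PXM PXM_omega_prod[OF PXM PXM] PXM_omega_prod[OF PXM PXM_omega_prod[OF PXM PXM]]
      unfolding PXM_def by blast+
    have wf: "wf_term v" using v by (simp add: vanishing_terms_def)
    have "range (\<lambda>i. (m i \<otimes> n i, m i, n i)) \<subseteq> carrier P"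
      using rg T.subset by blast
    then show ?thesis
      using P.eval_subalgebra[OF T wf rg] unfolding T'_def P_def
      by (simp add: eval_omega_prod[OF og(1,2,3) wf] eval_omega_prod[OF og(1,1,2) wf]
          image_subset_iff comp_def)
  qed
  \<comment> \<open>Membership in \<open>Z\<close> says that the first component is the product of
    the other two, which is the claim.\<close>
  ultimately show ?thesis by (auto simp: Z_def)
qed

end

section \<open>The relative commutator\<close>

context pxm
begin

definition cross_comms :: "'a set \<Rightarrow> 'a set \<Rightarrow> 'a set" where
  "cross_comms M N = {comm a b | a b. a \<in> ker Dom \<and> b \<in> ker Cod \<and> (a \<in> M \<and> b \<in> N \<or> a \<in> N \<and> b \<in> M)}"

text \<open>A commutator lies in every normal subgroup that contains one of its entries; each of the
  four subgroups contains \<open>a\<close> or \<open>b\<close>.\<close>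

lemma cross_comms_subset:
  assumes "M \<lhd> A" "N \<lhd> A"
  shows "cross_comms M N \<subseteq> ker f" "cross_comms M N \<subseteq> M \<inter> N"
proof -
  have ker: "ker f \<subseteq> carrier A" for f by (auto simp: mem_ker)
  have "comm a b \<in> ker f" if "a \<in> ker Dom" "b \<in> ker Cod" for a b
    using comm_in_normal[OF ker_normal, of a b f] that ker by (cases f) auto
  then show "cross_comms M N \<subseteq> ker f" by (auto simp: cross_comms_def)
  show "cross_comms M N \<subseteq> M \<inter> N"
    using comm_in_normal[OF assms(1)] comm_in_normal[OF assms(2)]
    by (auto simp: cross_comms_def mem_ker)
qed

definition peiffer_ideal :: "'a set \<Rightarrow> 'a set \<Rightarrow> 'a set" where
  "peiffer_ideal M N = generate A (cross_comms M N)"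

lemma peiffer_ideal_subset:
  assumes "M \<lhd> A" "N \<lhd> A"
  shows "peiffer_ideal M N \<subseteq> ker f" "peiffer_ideal M N \<subseteq> M \<inter> N"
proof -
  have "subgroup (ker f) A" "subgroup (M \<inter> N) A"
    using assms ker_normal by (simp_all add: normal_imp_subgroup subgroups_Inter_pair)
  then show "peiffer_ideal M N \<subseteq> ker f" "peiffer_ideal M N \<subseteq> M \<inter> N"
    unfolding peiffer_ideal_def
    using generate_subgroup_incl cross_comms_subset[OF assms] by blast+
qed

text \<open>The generators are stable under conjugation, so the subgroup they generate is already
  normal; the operations send all of it to the unit.\<close>

lemma omega_ideal_peiffer_ideal:
  assumes "M \<lhd> A" "N \<lhd> A"
  shows "omega_ideal PXM A (peiffer_ideal M N)"
proof -
  interpret M: normal M A by fact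
  interpret N: normal N A by fact
  interpret ker: normal "ker f" A for f by (rule ker_normal)
  have sub: "cross_comms M N \<subseteq> carrier A"
    using cross_comms_subset(2)[OF assms] by auto
  have "g \<otimes> x \<otimes> inv g \<in> cross_comms M N" if x: "x \<in> cross_comms M N" and g: "g \<in> carrier A" for x g
  proof -
    obtain a b where ab: "x = comm a b" "a \<in> ker Dom" "b \<in> ker Cod" "a \<in> M \<and> b \<in> N \<or> a \<in> N \<and> b \<in> M"
      using x by (auto simp: cross_comms_def)
    then have "g \<otimes> x \<otimes> inv g = comm (g \<otimes> a \<otimes> inv g) (g \<otimes> b \<otimes> inv g)"
      using g by (simp add: conj_comm mem_ker)
    moreover have "g \<otimes> a \<otimes> inv g \<in> ker Dom" "g \<otimes> b \<otimes> inv g \<in> ker Cod"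
      using ab g by (simp_all only: ker.inv_op_closed2)
    moreover have "g \<otimes> a \<otimes> inv g \<in> M \<and> g \<otimes> b \<otimes> inv g \<in> N \<or>
        g \<otimes> a \<otimes> inv g \<in> N \<and> g \<otimes> b \<otimes> inv g \<in> M"
      using ab(4) M.inv_op_closed2[OF g] N.inv_op_closed2[OF g] by metis
    ultimately show ?thesis
      unfolding cross_comms_def by blast
  qed
  then have "peiffer_ideal M N \<lhd> A"
    unfolding peiffer_ideal_def using normal_generateI[OF sub] by blast
  moreover have "opr f x \<in> peiffer_ideal M N" if "x \<in> peiffer_ideal M N" for f x
    using that peiffer_ideal_subset(1)[OF assms, of f] generate.one[of A]
    by (auto simp: mem_ker peiffer_ideal_def)
  ultimately show ?thesis by (simp add: omega_ideal_iff)
qed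

text \<open>A pair to be commuted in \<open>B\<close> lifts, entry by entry, to the matching kernels
  and ideals of \<open>A\<close>. The commutator of the lifts is a generator of
  \<open>peiffer_ideal M N\<close>, so \<open>h\<close> kills it.\<close>

lemma commuting_ideals_quotient:
  assumes M: "omega_ideal PXM A M" and N: "omega_ideal PXM A N"
    and B: "PXM B" "h \<in> omega_hom A B" "h ` carrier A = carrier B"
    and ker: "peiffer_ideal M N \<subseteq> kernel A B h"
  shows "commuting_ideals B (h ` M) (h ` N)"
proof -
  interpret B: pxm B by unfold_locales fact
  interpret h: group_hom A B h
    using B by unfold_locales (simp add: omega_hom_def)
  have op: "B.opr f (h x) = h (opr f x)" if "x \<in> carrier A" for f x
    using B(2) that by (simp add: omega_hom_pxm_iff)
  have ideal: "omega_ideal PXM B (h ` I)" if "omega_ideal PXM A I" for I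
  proof -
    have I: "I \<lhd> A" "\<And>f x. x \<in> I \<Longrightarrow> opr f x \<in> I" using that by (auto simp: omega_ideal_iff)
    interpret I: normal I A by (rule I)
    show ?thesis
      unfolding B.omega_ideal_iff
      using I.surj_hom_normal_subgroup[OF h.group_hom_axioms B(3)] I(2) by (auto simp: op)
  qed
  have *: "a \<otimes>\<^bsub>B\<^esub> b = b \<otimes>\<^bsub>B\<^esub> a"
    if ker_ab: "a \<in> B.ker Dom" "b \<in> B.ker Cod" and im: "a \<in> h ` I" "b \<in> h ` J"
      and IJ: "I = M \<and> J = N \<or> I = N \<and> J = M" for a b I J
  proof -
    have sub: "omega_subalgebra I A" "omega_subalgebra J A"
      using IJ M N by (auto simp: omega_ideal_def)
    have ab: "B.opr Dom a = \<one>\<^bsub>B\<^esub>" "B.opr Cod b = \<one>\<^bsub>B\<^esub>"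
      using ker_ab unfolding B.mem_ker by blast+
    obtain a' where a': "a' \<in> I" "a' \<in> ker Dom" "h a' = a"
      by (rule ker_lift[OF B(1,2) sub(1) im(1) ab(1)])
    obtain b' where b': "b' \<in> J" "b' \<in> ker Cod" "h b' = b"
      by (rule ker_lift[OF B(1,2) sub(2) im(2) ab(2)])
    have "comm a' b' \<in> cross_comms M N"
      using a' b' IJ unfolding cross_comms_def by blast
    then have "comm a' b' \<in> kernel A B h"
      using ker generate.incl[of _ "cross_comms M N" A] unfolding peiffer_ideal_def by blast
    then have "h (comm a' b') = \<one>\<^bsub>B\<^esub>" by (simp add: kernel_def)
    moreover have "a' \<in> carrier A" "b' \<in> carrier A" using a' b' unfolding mem_ker by blast+
    moreover from this have "h (comm a' b') = B.comm a b"
      using a' b' by (auto simp: comm_def B.comm_def)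
    ultimately show ?thesis
      using B.comm_eq_one_iff[of a b] a' b' by auto
  qed
  show ?thesis
    by unfold_locales (use ideal M N * in blast)+
qed

text \<open>Projecting to the quotient by \<open>peiffer_ideal M N\<close> reduces both claims to
  \<open>eval_mult\<close> and \<open>eval_inter\<close>.\<close>

lemma eval_relators_in_peiffer_ideal:
  assumes M: "omega_ideal PXM A M" and N: "omega_ideal PXM A N" and v: "v \<in> vanishing_terms XM"
  shows "range m \<subseteq> M \<Longrightarrow> range n \<subseteq> N \<Longrightarrow>
      eval A v (\<lambda>i. m i \<otimes> n i) \<otimes> inv (eval A v n) \<otimes> inv (eval A v m) \<in> peiffer_ideal M N"
    and "range p \<subseteq> M \<inter> N \<Longrightarrow> eval A v p \<in> peiffer_ideal M N"
proof -
  have normals: "M \<lhd> A" "N \<lhd> A" using M N by (simp_all add: omega_ideal_iff)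
  have sub: "M \<subseteq> carrier A" "N \<subseteq> carrier A"
    using normals by (simp_all add: normal_imp_subgroup subgroup.subset)
  have P: "peiffer_ideal M N \<lhd> A" "\<And>f x. x \<in> peiffer_ideal M N \<Longrightarrow> opr f x \<in> peiffer_ideal M N"
    using omega_ideal_peiffer_ideal[OF normals] by (auto simp: omega_ideal_iff)
  obtain B :: "('a set, pxm_op) omega_struct" and h
    where B: "PXM B" "h \<in> omega_hom A B" "h ` carrier A = carrier B" "kernel A B h = peiffer_ideal M N"
    by (rule quotient[OF P])
  interpret B: commuting_ideals B "h ` M" "h ` N"
    using commuting_ideals_quotient[OF M N B(1-3)] B(4) by simp
  interpret h: group_hom A B h
    using B by unfold_locales (simp add: omega_hom_def)
  have wf: "wf_term v" using v by (simp add: vanishing_terms_def)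
  have hom: "eval A v x \<in> carrier A" "h (eval A v x) = eval B v (h \<circ> x)" if "range x \<subseteq> carrier A" for x
    using eval_omega_hom[OF _ _ B(2) wf that] B(1) PXM by (simp_all add: PXM_def)
  show "eval A v (\<lambda>i. m i \<otimes> n i) \<otimes> inv (eval A v n) \<otimes> inv (eval A v m) \<in> peiffer_ideal M N"
    if m: "range m \<subseteq> M" and n: "range n \<subseteq> N"
  proof -
    have mi: "m i \<in> carrier A" and ni: "n i \<in> carrier A" for i
      using m n sub by blast+
    then have rg: "range m \<subseteq> carrier A" "range n \<subseteq> carrier A" "range (\<lambda>i. m i \<otimes> n i) \<subseteq> carrier A"
      by auto
    have "h (eval A v (\<lambda>i. m i \<otimes> n i)) = eval B v (\<lambda>i. (h \<circ> m) i \<otimes>\<^bsub>B\<^esub> (h \<circ> n) i)"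
      using hom(2)[OF rg(3)] mi ni by (simp add: comp_def)
    also have "\<dots> = eval B v (h \<circ> m) \<otimes>\<^bsub>B\<^esub> eval B v (h \<circ> n)"
      using m n by (intro B.eval_mult[OF v]) auto
    also have "\<dots> = h (eval A v m \<otimes> eval A v n)"
      using hom rg by simp
    finally have "h (eval A v (\<lambda>i. m i \<otimes> n i) \<otimes> inv (eval A v n) \<otimes> inv (eval A v m)) = \<one>\<^bsub>B\<^esub>"
      using hom(1) rg by (simp add: B.m_assoc B.inv_cancel_left)
    then show ?thesis
      unfolding B(4)[symmetric] kernel_def using hom(1) rg by simp
  qed
  show "eval A v p \<in> peiffer_ideal M N" if p: "range p \<subseteq> M \<inter> N"
  proof -
    have rg: "range p \<subseteq> carrier A" using p sub by blast
    have "eval B v (h \<circ> p) = \<one>\<^bsub>B\<^esub>"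
      using p by (intro B.eval_inter[OF v]) auto
    then show ?thesis
      unfolding B(4)[symmetric] kernel_def using hom[OF rg] by simp
  qed
qed

end

text \<open>
  As the group elements \<open>a\<close> with \<open>d(a) = 1\<close> and \<open>b\<close> with \<open>c(b) = 1\<close> are those of the form
  \<open>x d(x)\<inverse>\<close> and \<open>y c(y)\<inverse>\<close>, this is the defining identity of \<open>XM\<close> as a single term.
\<close>

definition cross_term :: "pxm_op oterm" where
  "cross_term = (let a = Mult (Var 0) (Inv (Op Dom [Var 0])); b = Mult (Var 1) (Inv (Op Cod [Var 1]))
     in Mult (Mult (Mult a b) (Inv a)) (Inv b))"

lemma (in pxm) eval_cross_term:
  "eval A cross_term x = comm (x 0 \<otimes> inv (opr Dom (x 0))) (x 1 \<otimes> inv (opr Cod (x 1)))"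
  by (simp add: cross_term_def comm_def Let_def)

lemma cross_term_vanishes: "cross_term \<in> vanishing_terms XM"
proof -
  have "eval B cross_term b = \<one>\<^bsub>B\<^esub>" if "XM B" "range b \<subseteq> carrier B"
    for B :: "(nat, pxm_op) omega_struct" and b
  proof -
    interpret B: pxm B using that by unfold_locales (simp add: XM_def)
    have "b i \<in> carrier B" for i using that(2) by blast
    \<comment> \<open>Idempotence of the operations puts the two entries of the commutator into the
      kernels of \<open>Dom\<close> and \<open>Cod\<close>.\<close>
    then have "b i \<otimes>\<^bsub>B\<^esub> inv\<^bsub>B\<^esub> B.opr f (b i) \<in> B.ker f" for i f
      unfolding B.mem_ker by simp
    then show ?thesis
      using that(1) by (simp add: B.XM_iff B.eval_cross_term)
  qed
  then show ?thesis
    by (simp add: vanishing_terms_def) (simp add: cross_term_def Let_def arity_pxm_op_def)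
qed

lemma (in pxm) comm_one [simp]:
  "x \<in> carrier A \<Longrightarrow> comm x \<one> = \<one>" "x \<in> carrier A \<Longrightarrow> comm \<one> x = \<one>"
  by (simp_all add: comm_def)

theorem (in pxm) relative_commutator_eq:
  assumes M: "omega_ideal PXM A M" and N: "omega_ideal PXM A N"
  shows "relative_commutator PXM XM A M N = peiffer_ideal M N"
proof -
  have normals: "M \<lhd> A" "N \<lhd> A" using M N by (simp_all add: omega_ideal_iff)
  interpret M: normal M A by (rule normals)
  interpret N: normal N A by (rule normals)
  define J where "J = omega_join A M N"
  define S where "S = {eval A v (\<lambda>i. m i \<otimes> n i) \<otimes> inv (eval A v n) \<otimes> inv (eval A v m) |
       v m n. v \<in> vanishing_terms XM \<and> range m \<subseteq> M \<and> range n \<subseteq> N} \<union>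
     {eval A v p | v p. v \<in> vanishing_terms XM \<and> range p \<subseteq> M \<inter> N}"
  have R: "relative_commutator PXM XM A M N = ideal_generated PXM (A\<lparr>carrier := J\<rparr>) S"
    by (simp add: relative_commutator_def S_def J_def)
  have "subgroup J A"
    unfolding J_def omega_join_def
    by (rule subgroups_Inter) (use carrier_subalgebra M.subset N.subset in \<open>auto simp: omega_subalgebra_def\<close>)
  then have J: "omega_subalgebra J A" "M \<subseteq> J"
    by (auto simp: omega_subalgebra_def omega_closed_pxm_iff J_def omega_join_def)
  interpret J: pxm "A\<lparr>carrier := J\<rparr>"
    using omega_subalgebra_PXM[OF PXM J(1)] by unfold_locales
  have "omega_ideal PXM (A\<lparr>carrier := J\<rparr>) (peiffer_ideal M N)"
    using omega_ideal_peiffer_ideal[OF normals] J peiffer_ideal_subset(2)[OF normals]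
    by (intro omega_ideal_subalgebra) auto
  moreover have "S \<subseteq> peiffer_ideal M N"
    using eval_relators_in_peiffer_ideal[OF M N] by (auto simp: S_def)
  ultimately have "ideal_generated PXM (A\<lparr>carrier := J\<rparr>) S \<subseteq> peiffer_ideal M N"
    by (auto simp: ideal_generated_def)
  moreover have "cross_comms M N \<subseteq> S"
  proof
    fix x assume "x \<in> cross_comms M N"
    then obtain a b where ab: "x = comm a b" "a \<in> ker Dom" "b \<in> ker Cod"
      "a \<in> M \<and> b \<in> N \<or> a \<in> N \<and> b \<in> M"
      by (auto simp: cross_comms_def)
    have abA: "a \<in> carrier A" "b \<in> carrier A" "opr Dom a = \<one>" "opr Cod b = \<one>"
      using ab unfolding mem_ker by blast+
    \<comment> \<open>Variable 0 carries \<open>a\<close> and variable 1 carries \<open>b\<close>,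
      with the unit elsewhere. On either assignment alone \<open>cross_term\<close> is trivial,
      while on their product it gives \<open>comm a b\<close>.\<close>
    define \<alpha> where "\<alpha> i = (if i = (0::nat) then a else \<one>)" for i
    define \<beta> where "\<beta> i = (if i = (1::nat) then b else \<one>)" for i
    \<comment> \<open>Two orders of multiplication are provided because the left factor must come
      from \<open>M\<close>, and either \<open>a\<close> or \<open>b\<close> may be the entry in
      \<open>M\<close>.\<close>
    have mult: "eval A cross_term (\<lambda>i. \<alpha> i \<otimes> \<beta> i) \<otimes> inv (eval A cross_term \<beta>) \<otimes> inv (eval A cross_term \<alpha>) = x"
      "eval A cross_term (\<lambda>i. \<beta> i \<otimes> \<alpha> i) \<otimes> inv (eval A cross_term \<alpha>) \<otimes> inv (eval A cross_term \<beta>) = x"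
      using abA by (simp_all add: eval_cross_term \<alpha>_def \<beta>_def ab(1))
    have S: "x \<in> S"
      if "range m \<subseteq> M" "range n \<subseteq> N"
        "eval A cross_term (\<lambda>i. m i \<otimes> n i) \<otimes> inv (eval A cross_term n) \<otimes> inv (eval A cross_term m) = x"
      for m n
      unfolding S_def using that cross_term_vanishes by blast
    have "range \<alpha> \<subseteq> M" if "a \<in> M" using that by (auto simp: \<alpha>_def)
    moreover have "range \<alpha> \<subseteq> N" if "a \<in> N" using that by (auto simp: \<alpha>_def)
    moreover have "range \<beta> \<subseteq> M" if "b \<in> M" using that by (auto simp: \<beta>_def)
    moreover have "range \<beta> \<subseteq> N" if "b \<in> N" using that by (auto simp: \<beta>_def)
    ultimately show "x \<in> S"
      using ab(4) S[OF _ _ mult(1)] S[OF _ _ mult(2)] by argo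
  qed
  then have "peiffer_ideal M N \<subseteq> I" if "omega_ideal PXM (A\<lparr>carrier := J\<rparr>) I" "S \<subseteq> I" for I
  proof -
    have "subgroup I A"
      using that(1) incl_subgroup[OF \<open>subgroup J A\<close>] by (auto simp: omega_ideal_def omega_subalgebra_def)
    then show ?thesis
      unfolding peiffer_ideal_def using that(2) \<open>cross_comms M N \<subseteq> S\<close>
      by (intro generate_subgroup_incl) auto
  qed
  then have "peiffer_ideal M N \<subseteq> ideal_generated PXM (A\<lparr>carrier := J\<rparr>) S"
    unfolding ideal_generated_def by blast
  ultimately show ?thesis using R by simp
qed

section \<open>Comparison with the Peiffer commutator\<close>

lemma (in group) subgroup_of_subgroup_monoid:
  assumes "subgroup H G" "subgroup K \<lparr>carrier = H, mult = mult G, one = \<one>\<rparr>"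
  shows "subgroup K G"
  using assms subgroup_monoid(2)[OF assms(1)] subgroup.subset[OF assms(1)]
  by (auto simp: subgroup_def subset_iff)

lemma normal_closure_eqI:
  assumes "H \<lhd> G" "X \<subseteq> H" "\<And>I. I \<lhd> G \<Longrightarrow> X \<subseteq> I \<Longrightarrow> H \<subseteq> I"
  shows "normal_closure G X = H"
  using assms unfolding normal_closure_def by blast

context pxm
begin

text \<open>With g = c(k), a = g l g^-1 and b = k g^-1, the conjugate b a b^-1 equals k l k^-1, so
  the Peiffer element is b a b^-1 a^-1.\<close>

lemma peiffer_pxm:
  assumes k: "k \<in> ker Dom" and l: "l \<in> ker Dom"
  shows "peiffer (pxm_to_pxmod A) k l =
    inv (comm (opr Cod k \<otimes> l \<otimes> inv (opr Cod k)) (k \<otimes> inv (opr Cod k)))"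
proof -
  interpret ker: normal "ker f" A for f by (rule ker_normal)
  have [simp]: "k \<in> carrier A" "l \<in> carrier A" using k l by (simp_all only: mem_ker)
  \<comment> \<open>The action is restricted to the image of d, so c(k) must be shown to lie
    there.\<close>
  have "opr Cod k = opr Dom (opr Cod k)" by simp
  then have "opr Cod k \<in> opr Dom ` carrier A" by (rule image_eqI) simp
  moreover have "opr Cod k \<otimes> l \<otimes> inv (opr Cod k) \<in> ker Dom"
    using l by (simp add: ker.inv_op_closed2)
  ultimately show ?thesis
    using k l subgroup_monoid(2)[OF ker.subgroup_axioms, of _ Dom]
    by (simp add: peiffer_def pxm_to_pxmod_def Let_def comm_def inv_mult_group m_assoc inv_cancel_left)
qed

text \<open>
  The map \<open>k \<mapsto> k c(k)\<inverse>\<close> is a bijection from the kernel of \<open>d\<close> to the kernel of \<open>c\<close>, with inverse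
  \<open>b \<mapsto> b d(b)\<inverse>\<close>.
\<close>

lemma peiffer_eq_inv_comm:
  assumes "M \<lhd> A" "omega_ideal PXM A N"
  shows "{peiffer (pxm_to_pxmod A) k l | k l. k \<in> ker Dom \<inter> N \<and> l \<in> ker Dom \<inter> M} =
    {inv (comm a b) | a b. a \<in> ker Dom \<and> b \<in> ker Cod \<and> a \<in> M \<and> b \<in> N}"
    (is "?L = ?R")
proof (intro equalityI subsetI)
  interpret M: normal M A by fact
  interpret N: normal N A using assms(2) by (simp add: omega_ideal_iff)
  interpret ker: normal "ker f" A for f by (rule ker_normal)
  have opN: "opr f x \<in> N" if "x \<in> N" for f x
    using assms(2) that by (simp add: omega_ideal_iff)
  {
    fix x assume "x \<in> ?L"
    then obtain k l where kl: "k \<in> ker Dom" "k \<in> N" "l \<in> ker Dom" "l \<in> M"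
      "x = peiffer (pxm_to_pxmod A) k l" by blast
    have [simp]: "k \<in> carrier A" using kl(2) by simp
    have "opr Cod k \<otimes> l \<otimes> inv (opr Cod k) \<in> ker Dom" "opr Cod k \<otimes> l \<otimes> inv (opr Cod k) \<in> M"
      using kl by (simp_all add: ker.inv_op_closed2 M.inv_op_closed2)
    moreover have "k \<otimes> inv (opr Cod k) \<in> N" using kl(2) opN by simp
    moreover have "k \<otimes> inv (opr Cod k) \<in> ker Cod" unfolding mem_ker by simp
    ultimately show "x \<in> ?R"
      unfolding kl(5) peiffer_pxm[OF kl(1,3)] by blast
  next
    fix x assume "x \<in> ?R"
    then obtain a b where ab: "a \<in> ker Dom" "b \<in> ker Cod" "a \<in> M" "b \<in> N" "x = inv (comm a b)"
      by blast
    have c: "a \<in> carrier A" "b \<in> carrier A" "opr Cod b = \<one>" using ab(1,2) unfolding mem_ker by simp_all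
    \<comment> \<open>Then c(k) = d(b)^-1 because c(b) = 1, whence k c(k)^-1 = b. The choice of
      \<open>l\<close> undoes the conjugation by c(k).\<close>
    define k where "k = b \<otimes> inv (opr Dom b)"
    define l where "l = inv (opr Cod k) \<otimes> a \<otimes> opr Cod k"
    have k: "k \<in> ker Dom" "k \<in> N" "k \<in> carrier A" "k \<otimes> inv (opr Cod k) = b"
      using c ab(4) opN unfolding mem_ker by (simp_all add: k_def m_assoc)
    have l: "l \<in> ker Dom" "l \<in> M" "opr Cod k \<otimes> l \<otimes> inv (opr Cod k) = a"
      using k(3) c ab by (simp_all add: l_def ker.inv_op_closed1 M.inv_op_closed1)
        (simp add: m_assoc inv_cancel_left)
    have "x = peiffer (pxm_to_pxmod A) k l"
      unfolding peiffer_pxm[OF k(1) l(1)] k(4) l(3) ab(5) ..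
    then show "x \<in> ?L" using k l by blast
  }
qed

text \<open>The Peiffer elements are the inverses of the generators of
  \<open>peiffer_ideal M N\<close>, which is normal in all of \<open>A\<close> and lies in
  \<open>H\<close>. So its normal closure is the same in any such \<open>H\<close>, in particular in
  the join of the top groups.\<close>

lemma normal_closure_peiffer:
  assumes M: "omega_ideal PXM A M" and N: "omega_ideal PXM A N"
    and H: "subgroup H A" "ker Dom \<inter> M \<subseteq> H"
  shows "normal_closure \<lparr>carrier = H, mult = mult A, one = \<one>\<rparr>
      ({peiffer (pxm_to_pxmod A) k l | k l. k \<in> ker Dom \<inter> M \<and> l \<in> ker Dom \<inter> N} \<union>
       {peiffer (pxm_to_pxmod A) l k | k l. k \<in> ker Dom \<inter> M \<and> l \<in> ker Dom \<inter> N}) =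
    peiffer_ideal M N"
    (is "normal_closure ?G ?X = ?P")
proof -
  have normals: "M \<lhd> A" "N \<lhd> A" using M N by (simp_all add: omega_ideal_iff)
  have X: "?X = {inv x | x. x \<in> cross_comms M N}"
  proof -
    have "{peiffer (pxm_to_pxmod A) l k | k l. k \<in> ker Dom \<inter> M \<and> l \<in> ker Dom \<inter> N} =
        {inv (comm a b) | a b. a \<in> ker Dom \<and> b \<in> ker Cod \<and> a \<in> M \<and> b \<in> N}"
      unfolding peiffer_eq_inv_comm[OF normals(1) N, symmetric] by blast
    then show ?thesis
      unfolding peiffer_eq_inv_comm[OF normals(2) M] cross_comms_def by blast
  qed
  have sub: "cross_comms M N \<subseteq> carrier A"
    using cross_comms_subset(2)[OF normals] subgroup.subset[OF normal_imp_subgroup[OF normals(1)]]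
    by blast
  have PH: "?P \<subseteq> H" using peiffer_ideal_subset[OF normals] H(2) by blast
  interpret P: normal ?P A
    using omega_ideal_peiffer_ideal[OF normals] by (simp add: omega_ideal_iff)
  interpret H: subgroup H A by fact
  note G = subgroup_monoid[OF H(1)]
  have "?P \<lhd> ?G"
    using subgroup_monoid_subgroup[OF H(1) P.subgroup_axioms PH] G(2) P.inv_op_closed2
    by (auto simp: group.normal_inv_iff[OF G(1)])
  moreover have "cross_comms M N \<subseteq> ?P"
    unfolding peiffer_ideal_def by (auto intro: generate.incl)
  then have "?X \<subseteq> ?P" unfolding X by blast
  moreover have "?P \<subseteq> I" if I: "I \<lhd> ?G" "?X \<subseteq> I" for I
  proof -
    have I': "subgroup I A"
      using subgroup_of_subgroup_monoid[OF H(1) normal_imp_subgroup[OF I(1)]] .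
    have "x \<in> I" if "x \<in> cross_comms M N" for x
    proof -
      have "inv x \<in> I" using that I(2) unfolding X by blast
      moreover have "x \<in> carrier A" using that sub by blast
      ultimately show ?thesis using subgroup.m_inv_closed[OF I', of "inv x"] by simp
    qed
    then show ?thesis
      unfolding peiffer_ideal_def by (rule generate_subgroup_incl[OF subsetI I'])
  qed
  ultimately show ?thesis by (rule normal_closure_eqI)
qed

lemma carrier_top_group_subalgebra:
  assumes "omega_subalgebra S A"
  shows "carrier (top_group (pxm_to_pxmod (A\<lparr>carrier := S\<rparr>))) = ker Dom \<inter> S"
  unfolding pxm_to_pxmod_subalgebra[OF PXM assms] by (simp add: restrict_pxmod_def)

lemma pxm_to_pxmod_relative_commutator:
  assumes "omega_ideal PXM A M" and "omega_ideal PXM A N"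
  shows "pxm_to_pxmod (A\<lparr>carrier := relative_commutator PXM XM A M N\<rparr>) =
    peiffer_commutator (pxm_to_pxmod A)
      (pxm_to_pxmod (A\<lparr>carrier := M\<rparr>)) (pxm_to_pxmod (A\<lparr>carrier := N\<rparr>))"
proof -
  have normals: "M \<lhd> A" "N \<lhd> A" using assms by (simp_all add: omega_ideal_iff)
  have sub: "omega_subalgebra M A" "omega_subalgebra N A"
    using assms by (simp_all add: omega_ideal_def)
  define P where "P = peiffer_ideal M N"
  have P: "omega_subalgebra P A" "P \<subseteq> ker f" for f
    using omega_ideal_peiffer_ideal[OF normals] peiffer_ideal_subset(1)[OF normals]
    by (auto simp: P_def omega_ideal_def)
  have kerP: "ker Dom \<inter> P = P" using P(2) by blast
  \<comment> \<open>This accounts for the trivial base group: d fixes its own image pointwise but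
    sends \<open>P\<close> to the unit.\<close>
  have imP: "opr Dom ` carrier A \<inter> P = {\<one>}"
  proof (intro equalityI subsetI)
    fix x assume x: "x \<in> opr Dom ` carrier A \<inter> P"
    then have "opr Dom x = x" by auto
    moreover have "opr Dom x = \<one>" using x P(2)[of Dom] unfolding mem_ker subset_iff by blast
    ultimately show "x \<in> {\<one>}" by simp
  next
    fix x assume "x \<in> {\<one>}"
    moreover have "\<one> \<in> P" using P(1) by (simp add: omega_subalgebra_def subgroup.one_closed)
    moreover have "\<one> \<in> opr Dom ` carrier A" by (rule image_eqI[of _ _ \<one>]) simp_all
    ultimately show "x \<in> opr Dom ` carrier A \<inter> P" by simp
  qed
  let ?K = "\<lparr>carrier = ker Dom, mult = mult A, one = \<one>\<rparr>"
  have top: "top_group (pxm_to_pxmod A) = ?K" "\<one>\<^bsub>base_group (pxm_to_pxmod A)\<^esub> = \<one>"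
    by (simp_all add: pxm_to_pxmod_def Let_def)
  define H where "H = generate ?K ((ker Dom \<inter> M) \<union> (ker Dom \<inter> N))"
  have ker: "subgroup (ker Dom) A" using ker_normal by (rule normal_imp_subgroup)
  have "subgroup H ?K"
    unfolding H_def by (rule group.generate_is_subgroup[OF subgroup_monoid(1)[OF ker]]) auto
  then have "subgroup H A" by (rule subgroup_of_subgroup_monoid[OF ker])
  moreover have "ker Dom \<inter> M \<subseteq> H" unfolding H_def by (auto intro: generate.incl)
  ultimately have "peiffer_commutator (pxm_to_pxmod A)
      (pxm_to_pxmod (A\<lparr>carrier := M\<rparr>)) (pxm_to_pxmod (A\<lparr>carrier := N\<rparr>)) =
    restrict_pxmod (pxm_to_pxmod A) P {\<one>}"
    using normal_closure_peiffer[OF assms]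
    unfolding peiffer_commutator_def Let_def carrier_top_group_subalgebra[OF sub(1)]
      carrier_top_group_subalgebra[OF sub(2)] top P_def H_def by simp
  then show ?thesis
    using pxm_to_pxmod_subalgebra[OF PXM P(1)] relative_commutator_eq[OF assms]
    unfolding kerP imP by (simp add: P_def)
qed

end

theorem proposition2p3:
  fixes A :: "('a, pxm_op) omega_struct" and M N :: "'a set"
  assumes "PXM A" and "omega_ideal PXM A M" and "omega_ideal PXM A N"
  shows "pxm_to_pxmod (A\<lparr>carrier := relative_commutator PXM XM A M N\<rparr>) =
    peiffer_commutator (pxm_to_pxmod A)
      (pxm_to_pxmod (A\<lparr>carrier := M\<rparr>)) (pxm_to_pxmod (A\<lparr>carrier := N\<rparr>))"
  using pxm.pxm_to_pxmod_relative_commutator[OF pxm.intro] assms .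

end
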